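(* Let $(m_0,m_1,\ldots,m_\ell)$ be an $(\ell+1)$-tuple of nonnegative integers which sum to $n$. Then, in the ring of symmetric functions, (a) $$s_{(m_0)}\prod_{r=1}^\ell \sum_{i=0}^{m_r} s_{(i)}s_{(m_r-i)}=\sum_{\lambda\in\mathcal P_n}|\mathcal T_{(m_0,m_1,\ldots,m_\ell)}^\lambda|\, s_\lambda,$$ (b) $$s_{(m_0)}\prod_{r=1}^\ell \sum_{i=0}^{2m_r}(-1)^i s_{(i)}s_{(2m_r-i)}=\sum_{\lambda\in\mathcal P_{2n-m_0}}(-1)^{n(\lambda)}\, |\mathcal D_{(m_0,m_1,\ldots,m_\ell)}^\lambda|\, s_\lambda.$$
   Context: $\mathcal P_n$ is the set of partitions of $n$, $s_\lambda$ is the Schur function of $\lambda$ (with $s_{(0)}=1$), and $n(\lambda)=\sum_i(i-1)\lambda_i$. Symplectic tableaux. Order the symbols $0<\bar1<1<\bar2<2<\cdots$. For a partition $\lambda$ of $m_0+m_1+\cdots+m_\ell$ with $m_0\le\lambda_1$, a symplectic tableau of shape $\lambda/(m_0)$ and weight $(m_0,m_1,\dots,m_\ell)$ is a filling of the boxes of $\lambda$ by symbols from $\{0,\bar1,1,\dots,\bar\ell,\ell\}$, weakly increasing along rows and strictly increasing down columns, with exactly $m_0$ entries equal to $0$ and, for each $1\le i\le\ell$, exactly $m_i$ entries in $\{\bar i,i\}$. $\mathcal T_{(m_0,\dots,m_\ell)}^\lambda$ is the set of these (empty if $m_0>\lambda_1$). Domino tableaux. A domino is a pair of adjacent boxes.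 For a partition $\lambda$ with $m_0\le\lambda_1$ and $|\lambda|=m_0+2(m_1+\cdots+m_\ell)$, a domino tableau of shape $\lambda/(m_0)$ and weight $(m_0,m_1,\dots,m_\ell)$ is a tiling of the skew shape $\lambda/(m_0)$ by dominoes, with a $0$ put in each of the $m_0$ untiled boxes (the first $m_0$ boxes of the first row), together with a labelling of the dominoes by $\{1,\dots,\ell\}$ such that exactly $m_i$ dominoes are labelled $i$, labels weakly increase along rows, and labels strictly increase down columns between distinct dominoes. $\mathcal D_{(m_0,\dots,m_\ell)}^\lambda$ is the set of these (empty if $m_0>\lambda_1$). *)

theory Defs
  imports Main "HOL-Library.FuncSet" "HOL-Library.Disjoint_Sets" "HOL-Library.Poly_Mapping"
begin

text \<open>
  The ring of formal power series \<open>\<int>[[x\<^sub>0, x\<^sub>1, x\<^sub>2, \<dots>]]\<close>: a monomial is a finitely supported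
  exponent vector, and a series is an arbitrary assignment of integer coefficients to monomials.
  The ring of symmetric functions is by definition the subring of the series of bounded degree
  that are invariant under permuting the variables, so an equation between symmetric functions is
  an equation in the ring below.
\<close>

typedef mfps = "UNIV :: ((nat \<Rightarrow>\<^sub>0 nat) \<Rightarrow> int) set"
  morphisms mcoeff Abs_mfps ..

setup_lifting type_definition_mfps

lemma mfps_eqI: "(\<And>u. mcoeff f u = mcoeff g u) \<Longrightarrow> f = g"
  by transfer auto

definition splits :: "(nat \<Rightarrow>\<^sub>0 nat) \<Rightarrow> ((nat \<Rightarrow>\<^sub>0 nat) \<times> (nat \<Rightarrow>\<^sub>0 nat)) set" where
  "splits u = {(a, b). a + b = u}"

lemma finite_splits: "finite (splits u)"
proof -
  let ?deg = "\<lambda>u :: nat \<Rightarrow>\<^sub>0 nat. sum (Poly_Mapping.lookup u) (Poly_Mapping.keys u)"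
  let ?H = "{h. \<forall>k. (k \<in> Poly_Mapping.keys u \<longrightarrow> h k \<in> {..?deg u}) \<and>
                  (k \<notin> Poly_Mapping.keys u \<longrightarrow> h k = 0)}"
  have "finite ?H"
    by (rule finite_set_of_finite_funs) simp_all
  moreover have "Poly_Mapping.lookup ` fst ` splits u \<subseteq> ?H"
  proof (clarsimp simp: splits_def, intro conjI allI impI)
    fix a b :: "nat \<Rightarrow>\<^sub>0 nat" and k
    assume "k \<in> Poly_Mapping.keys (a + b)"
    then have "Poly_Mapping.lookup (a + b) k \<le> ?deg (a + b)"
      by (intro member_le_sum) simp_all
    then show "Poly_Mapping.lookup a k \<le> ?deg (a + b)"
      by (simp add: lookup_add)
  next
    fix a b :: "nat \<Rightarrow>\<^sub>0 nat" and k
    assume "k \<notin> Poly_Mapping.keys (a + b)"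
    then have "Poly_Mapping.lookup a k + Poly_Mapping.lookup b k = 0"
      by (simp only: in_keys_iff lookup_add not_not)
    then show "Poly_Mapping.lookup a k = 0"
      by simp
  qed
  ultimately have "finite (Poly_Mapping.lookup ` fst ` splits u)"
    by (rule finite_subset[rotated])
  then have "finite (fst ` splits u)"
    by (rule finite_imageD) (simp add: inj_on_def poly_mapping_eqI)
  moreover have "inj_on fst (splits u)"
    by (auto simp: inj_on_def splits_def)
  ultimately show ?thesis
    by (rule finite_imageD)
qed

instantiation mfps :: comm_ring_1
begin

lift_definition zero_mfps :: mfps is "\<lambda>_. 0" .
lift_definition one_mfps :: mfps is "\<lambda>u. if u = 0 then 1 else 0" .
lift_definition plus_mfps :: "mfps \<Rightarrow> mfps \<Rightarrow> mfps" is "\<lambda>f g u. f u + g u" .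
lift_definition minus_mfps :: "mfps \<Rightarrow> mfps \<Rightarrow> mfps" is "\<lambda>f g u. f u - g u" .
lift_definition uminus_mfps :: "mfps \<Rightarrow> mfps" is "\<lambda>f u. - f u" .
lift_definition times_mfps :: "mfps \<Rightarrow> mfps \<Rightarrow> mfps"
  is "\<lambda>f g u. \<Sum>(a, b)\<in>splits u. f a * g b" .

instance
proof
  fix f g h :: mfps
  show "f * g * h = f * (g * h)"
  proof (transfer, rule ext)
    fix f g h :: "(nat \<Rightarrow>\<^sub>0 nat) \<Rightarrow> int" and u
    have "(\<Sum>(a, c)\<in>splits u. (\<Sum>(a, b)\<in>splits a. f a * g b) * h c) =
      (\<Sum>p\<in>splits u. \<Sum>q\<in>splits (fst p). f (fst q) * g (snd q) * h (snd p))"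
      by (simp add: case_prod_beta sum_distrib_right)
    also have "\<dots> = (\<Sum>(p, q)\<in>(SIGMA p:splits u. splits (fst p)).
        f (fst q) * g (snd q) * h (snd p))"
      by (subst sum.Sigma) (auto simp: finite_splits)
    also have "\<dots> = (\<Sum>(p, q)\<in>(SIGMA p:splits u. splits (snd p)).
        f (fst p) * g (fst q) * h (snd q))"
      by (rule sum.reindex_bij_witness
          [where i = "\<lambda>(p, q). ((fst p + fst q, snd q), (fst p, fst q))" and
                 j = "\<lambda>(p, q). ((fst q, snd q + snd p), (snd q, snd p))"])
        (auto simp: splits_def add.assoc)
    also have "\<dots> = (\<Sum>p\<in>splits u. \<Sum>q\<in>splits (snd p). f (fst p) * g (fst q) * h (snd q))"
      by (subst sum.Sigma) (auto simp: finite_splits)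
    also have "\<dots> = (\<Sum>(a, c)\<in>splits u. f a * (\<Sum>(b, c)\<in>splits c. g b * h c))"
      by (simp add: case_prod_beta sum_distrib_left mult.assoc)
    finally show "(\<Sum>(a, c)\<in>splits u. (\<Sum>(a, b)\<in>splits a. f a * g b) * h c) =
      (\<Sum>(a, c)\<in>splits u. f a * (\<Sum>(b, c)\<in>splits c. g b * h c))" .
  qed
  show "f * g = g * f"
    by (transfer, rule ext, rule sum.reindex_bij_witness[where i = prod.swap and j = prod.swap])
      (auto simp: splits_def add.commute mult.commute)
  show "1 * f = f"
  proof (transfer, rule ext)
    fix f :: "(nat \<Rightarrow>\<^sub>0 nat) \<Rightarrow> int" and u
    have "(\<Sum>(a, b)\<in>splits u. (if a = 0 then 1 else 0) * f b) =
      (\<Sum>(a, b)\<in>{(0 :: nat \<Rightarrow>\<^sub>0 nat, u)}. (if a = 0 then 1 else 0) * f b)"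
      by (rule sum.mono_neutral_right) (use finite_splits[of u] in \<open>auto simp: splits_def split: if_splits\<close>)
    then show "(\<Sum>(a, b)\<in>splits u. (if a = 0 then 1 else 0) * f b) = f u"
      by simp
  qed
  show "(f + g) * h = f * h + g * h"
    by transfer (simp add: case_prod_beta distrib_right sum.distrib)
  show "(0 :: mfps) \<noteq> 1"
    by transfer (metis zero_neq_one)
qed (transfer; simp add: algebra_simps)+

end

text \<open>
  Partitions are weakly decreasing lists of positive parts. Rows and columns are numbered from 0,
  so \<open>part \<mu> i\<close> is \<open>\<mu>\<^sub>i\<^sub>+\<^sub>1\<close> in the usual numbering.
\<close>

definition partitions :: "nat \<Rightarrow> nat list set" where
  "partitions n = {\<mu>. sorted_wrt (\<ge>) \<mu> \<and> 0 \<notin> set \<mu> \<and> sum_list \<mu> = n}"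

definition part :: "nat list \<Rightarrow> nat \<Rightarrow> nat" where
  "part \<mu> i = (if i < length \<mu> then \<mu> ! i else 0)"

definition n_stat :: "nat list \<Rightarrow> nat" where
  "n_stat \<mu> = (\<Sum>i<length \<mu>. i * part \<mu> i)"

definition diagram :: "nat list \<Rightarrow> (nat \<times> nat) set" where
  "diagram \<mu> = {(i, j). j < part \<mu> i}"

definition semistandard :: "nat list \<Rightarrow> (nat \<times> nat \<Rightarrow> nat) \<Rightarrow> bool" where
  "semistandard \<mu> T \<longleftrightarrow>
     (\<forall>i j j'. (i, j) \<in> diagram \<mu> \<longrightarrow> (i, j') \<in> diagram \<mu> \<longrightarrow> j < j' \<longrightarrow> T (i, j) \<le> T (i, j')) \<and>
     (\<forall>i i' j. (i, j) \<in> diagram \<mu> \<longrightarrow> (i', j) \<in> diagram \<mu> \<longrightarrow> i < i' \<longrightarrow> T (i, j) < T (i', j))"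

text \<open>
  The coefficient of \<open>x\<^sup>u\<close> in \<open>s\<^sub>\<mu>\<close> is the number of semistandard tableaux of shape \<open>\<mu>\<close> and content
  \<open>u\<close>. Trailing zeros in \<open>\<mu>\<close> do not matter, so \<open>schur [k]\<close> is \<open>s\<^bsub>(k)\<^esub>\<close> also for \<open>k = 0\<close>.
\<close>

definition schur :: "nat list \<Rightarrow> mfps" where
  "schur \<mu> = Abs_mfps (\<lambda>u. int (card
     {T \<in> diagram \<mu> \<rightarrow>\<^sub>E UNIV. semistandard \<mu> T \<and>
        (\<forall>k. card {b \<in> diagram \<mu>. T b = k} = Poly_Mapping.lookup u k)}))"

lemma finite_partitions: "finite (partitions n)"
proof (rule finite_subset)
  have "length \<mu> \<le> sum_list \<mu>" if "0 \<notin> set \<mu>" for \<mu> :: "nat list"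
    using that by (induction \<mu>) auto
  then show "partitions n \<subseteq> {\<mu>. set \<mu> \<subseteq> {..n} \<and> length \<mu> \<le> n}"
    by (auto simp: partitions_def dest: member_le_sum_list)
  show "finite {\<mu>. set \<mu> \<subseteq> {..n} \<and> length \<mu> \<le> n}"
    by (rule finite_lists_length_le) simp
qed

lemma schur_zero: "schur [0] = 1"
proof (rule mfps_eqI)
  have "diagram [0] = {}"
    by (auto simp: diagram_def part_def)
  moreover have "(\<forall>k. Poly_Mapping.lookup u k = 0) \<longleftrightarrow> u = 0" for u :: "nat \<Rightarrow>\<^sub>0 nat"
    by (metis lookup_zero poly_mapping_eqI)
  ultimately show "mcoeff (schur [0]) u = mcoeff 1 u" for u
    by (auto simp: schur_def Abs_mfps_inverse one_mfps.rep_eq semistandard_def)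
qed

text \<open>
  The symbols \<open>0 < 1* < 1 < 2* < 2 < \<dots>\<close> (with \<open>i*\<close> for \<open>i\<close> barred) are encoded order-isomorphically by the natural
  numbers: \<open>i\<close> barred becomes \<open>2i - 1\<close> and \<open>i\<close> unbarred becomes \<open>2i\<close>, so the symbols up to \<open>\<ell>\<close>
  are \<open>{0..2\<ell>}\<close>.
\<close>

abbreviation (input) barred :: "nat \<Rightarrow> nat" where
  "barred i \<equiv> 2 * i - 1"

abbreviation (input) unbarred :: "nat \<Rightarrow> nat" where
  "unbarred i \<equiv> 2 * i"

text \<open>The weight \<open>(m\<^sub>0, \<dots>, m\<^sub>\<ell>)\<close> is given by \<open>l\<close> and a function, used only on \<open>{0..l}\<close>.\<close>

definition symplectic_tableaux ::
    "nat \<Rightarrow> (nat \<Rightarrow> nat) \<Rightarrow> nat list \<Rightarrow> (nat \<times> nat \<Rightarrow> nat) set" where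
  "symplectic_tableaux l m \<mu> =
     {T \<in> diagram \<mu> \<rightarrow>\<^sub>E {0..unbarred l}.
        m 0 \<le> part \<mu> 0 \<and> semistandard \<mu> T \<and>
        card {b \<in> diagram \<mu>. T b = 0} = m 0 \<and>
        (\<forall>i\<in>{1..l}. card {b \<in> diagram \<mu>. T b \<in> {barred i, unbarred i}} = m i)}"

definition domino :: "(nat \<times> nat) set \<Rightarrow> bool" where
  "domino d \<longleftrightarrow> (\<exists>i j. d = {(i, j), (i, j + 1)} \<or> d = {(i, j), (i + 1, j)})"

text \<open>
  A domino tableau is a tiling \<open>P\<close> of the skew shape together with a labelling \<open>f\<close> of its dominoes.
  The entries \<open>0\<close> in the first \<open>m\<^sub>0\<close> boxes of the first row are determined by \<open>m\<^sub>0\<close> and therefore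
  not recorded; they are smaller than all labels, and no box lies to the left of or above them
  except another \<open>0\<close>, so they do not affect the monotonicity conditions.
\<close>

definition domino_tableaux ::
    "nat \<Rightarrow> (nat \<Rightarrow> nat) \<Rightarrow> nat list \<Rightarrow> ((nat \<times> nat) set set \<times> ((nat \<times> nat) set \<Rightarrow> nat)) set" where
  "domino_tableaux l m \<mu> =
     {(P, f). m 0 \<le> part \<mu> 0 \<and>
        partition_on (diagram \<mu> - {0} \<times> {..<m 0}) P \<and> (\<forall>d\<in>P. domino d) \<and>
        f \<in> P \<rightarrow>\<^sub>E {1..l} \<and>
        (\<forall>i\<in>{1..l}. card {d \<in> P. f d = i} = m i) \<and>
        (\<forall>d\<in>P. \<forall>d'\<in>P. \<forall>i j j'. (i, j) \<in> d \<longrightarrow> (i, j') \<in> d' \<longrightarrow> j < j' \<longrightarrow> f d \<le> f d') \<and>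
        (\<forall>d\<in>P. \<forall>d'\<in>P. \<forall>i i' j.
           d \<noteq> d' \<longrightarrow> (i, j) \<in> d \<longrightarrow> (i', j) \<in> d' \<longrightarrow> i < i' \<longrightarrow> f d < f d')}"

end

theory Submission
  imports Defs
begin

text \<open>
  A partition is treated as a weakly decreasing function of finite support, and \<open>f / g\<close> is a
  horizontal strip iff \<open>f\<close> and \<open>g\<close> interlace. Splitting off the largest entries of a tableau shows
  that Schur functions in one more variable are sums over horizontal strips; Pieri's rule then
  follows by induction on the number of variables from a bijection exchanging partitions above and
  below two given ones. By Pieri, the coefficient of \<open>s\<^sub>f\<close> in
  \<open>s\<^sub>g \<Sum>\<^sub>i \<epsilon>\<^sup>i s\<^bsub>(i)\<^esub> s\<^bsub>(m-i)\<^esub>\<close> is the sum of \<open>\<epsilon>\<^bsup>|h/g|\<^esup>\<close> over all \<open>h\<close> between \<open>g\<close> and \<open>f\<close> for which \<open>h/g\<close>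
  and \<open>f/h\<close> are horizontal strips. For \<open>\<epsilon> = 1\<close> these \<open>h\<close> record the last pair of symbols of a
  symplectic tableau. For \<open>\<epsilon> = -1\<close> each part of \<open>h\<close> ranges independently over an interval, so the
  sum is a product of alternating sums; it vanishes unless all the intervals have an odd number of
  elements, which means that \<open>f/g\<close> has a (unique) tiling by dominoes no two of which meet a common
  column, and its sign is then \<open>(-1)\<^bsup>n(f) + n(g)\<^esup>\<close>.
\<close>

section \<open>Partitions as functions\<close>

text \<open>The series have infinitely many variables, while an induction needs a last one. A single
  coefficient involves only finitely many variables, so that of a Schur function is a Kostka number
  \<open>kostka N f c\<close> with entries bounded by \<open>N\<close>, and the induction on
  \<open>N\<close> takes place there. Shapes are functions on all of \<open>nat\<close> because
  neighbouring shapes in a chain can differ by one in their number of rows, and interlacing then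
  needs no mention of lengths. Both parts multiply by one factor at a time. The sum over i in a
  factor disappears because the intermediate shape h between g and f fixes i = |h| - |g|; all h are
  summed, with no condition on their size, and only this allows the parts of h to vary
  independently. In part (b) the signs (-1)^(n(f) + n(g)) of the steps telescope along the chain of
  shapes from (m_0), where n is 0, up to \<lambda>. Hence the sign in the theorem depends only on
  the shape and all domino tableaux of that shape count alike.\<close>

lemma all_nat_iff: "(\<forall>i. P i) \<longleftrightarrow> P 0 \<and> (\<forall>i. P (Suc i))"
proof (intro iffI allI conjI)
  fix i assume "P 0 \<and> (\<forall>i. P (Suc i))"
  then show "P i" by (cases i) auto
qed auto

definition young :: "(nat \<Rightarrow> nat) \<Rightarrow> bool" where
  "young f \<longleftrightarrow> antimono f \<and> finite {i. f i \<noteq> 0}"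

definition ysize :: "(nat \<Rightarrow> nat) \<Rightarrow> nat" where
  "ysize f = (\<Sum>i | f i \<noteq> 0. f i)"

definition boxes :: "(nat \<Rightarrow> nat) \<Rightarrow> (nat \<times> nat) set" where
  "boxes f = {(i, j). j < f i}"

text \<open>For partitions, column \<open>j\<close> has boxes of \<open>f / g\<close> in both rows
  \<open>i\<close> and \<open>Suc i\<close> exactly when \<open>g i \<le> j < f (Suc i)\<close>; the
  second inequality excludes this.\<close>

definition interlace :: "(nat \<Rightarrow> nat) \<Rightarrow> (nat \<Rightarrow> nat) \<Rightarrow> bool" where
  "interlace g f \<longleftrightarrow> (\<forall>i. g i \<le> f i \<and> f (Suc i) \<le> g i)"

lemma mem_boxes [simp]: "(i, j) \<in> boxes f \<longleftrightarrow> j < f i"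
  by (simp add: boxes_def)

lemma boxes_inject: "boxes f = boxes g \<longleftrightarrow> f = g"
proof
  assume eq: "boxes f = boxes g"
  have "j < f i \<longleftrightarrow> j < g i" for i j
    using eq mem_boxes by metis
  then show "f = g"
    by (metis ext linorder_neqE_nat less_irrefl_nat)
qed simp

lemma youngD: "young f \<Longrightarrow> i \<le> j \<Longrightarrow> f j \<le> f i"
  by (simp add: young_def antimono_def)

lemma young_bound:
  assumes "young f"
  obtains L where "\<And>i. L \<le> i \<Longrightarrow> f i = 0"
proof -
  obtain L where "\<forall>i\<in>{i. f i \<noteq> 0}. i < L"
    using assms finite_nat_set_iff_bounded unfolding young_def by metis
  then show ?thesis
    by (intro that[of L]) (metis linorder_not_less mem_Collect_eq)
qed

lemma youngI:
  assumes "\<And>i. f (Suc i) \<le> f i" "\<And>i. L \<le> i \<Longrightarrow> f i = 0"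
  shows "young f"
proof -
  have "{i. f i \<noteq> 0} \<subseteq> {..<L}"
    using assms(2) by (auto intro: ccontr simp: not_less)
  then show ?thesis
    using assms(1) by (auto simp: young_def antimono_iff_le_Suc intro: finite_subset)
qed

lemma ysize_eq: "(\<And>i. L \<le> i \<Longrightarrow> f i = 0) \<Longrightarrow> ysize f = (\<Sum>i<L. f i)"
  unfolding ysize_def
  by (rule sum.mono_neutral_left) (auto intro: ccontr simp: not_less)

lemma ysize_mono:
  assumes "young f" "\<And>i. g i \<le> f i"
  shows "ysize g \<le> ysize f"
proof -
  obtain L where L: "\<And>i. L \<le> i \<Longrightarrow> f i = 0"
    using young_bound[OF assms(1)] by blast
  then have "\<And>i. L \<le> i \<Longrightarrow> g i = 0"
    using assms(2) by (metis le_zero_eq)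
  then show ?thesis
    using L assms(2) by (simp add: ysize_eq[of L] sum_mono)
qed

text \<open>If row \<open>i\<close> is nonempty, so are all rows above it, which already makes
  \<open>Suc i\<close> boxes. The bound depends on the size alone, as the finiteness of the set of
  partitions of bounded size requires.\<close>

lemma young_support:
  assumes "young f" "ysize f \<le> i"
  shows "f i = 0"
proof (rule ccontr)
  assume nz: "f i \<noteq> 0"
  obtain L where L: "\<And>i. L \<le> i \<Longrightarrow> f i = 0"
    using young_bound[OF assms(1)] by blast
  have "Suc i \<le> L"
    using L nz by (meson not_less_eq_eq)
  have "Suc i = (\<Sum>k<Suc i. 1)" by simp
  also have "\<dots> \<le> (\<Sum>k<Suc i. f k)"
    using nz youngD[OF assms(1)] by (intro sum_mono) (metis lessThan_iff less_Suc_eq_le le_zero_eq less_one linorder_not_less)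
  also have "\<dots> \<le> (\<Sum>k<L. f k)"
    using \<open>Suc i \<le> L\<close> by (intro sum_mono2) auto
  finally show False
    using assms(2) ysize_eq[OF L] by simp
qed

lemma young_le_ysize:
  assumes "young f"
  shows "f i \<le> ysize f"
proof (cases "f i = 0")
  case False
  then show ?thesis
    using assms unfolding ysize_def young_def by (intro member_le_sum) auto
qed simp

lemma finite_young_size: "finite {f. young f \<and> ysize f \<le> n}"
proof (rule finite_subset)
  show "{f. young f \<and> ysize f \<le> n} \<subseteq>
      {f. \<forall>i. (i \<in> {..<n} \<longrightarrow> f i \<in> {..n}) \<and> (i \<notin> {..<n} \<longrightarrow> f i = 0)}"
    by (auto intro: young_support le_trans[OF young_le_ysize])
  show "finite \<dots>"
    by (rule finite_set_of_finite_funs) auto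
qed

lemma card_boxes:
  assumes "young f"
  shows "finite (boxes f)" "card (boxes f) = ysize f"
proof -
  obtain L where L: "\<And>i. L \<le> i \<Longrightarrow> f i = 0"
    using young_bound[OF assms] by blast
  then have "boxes f = (SIGMA i:{..<L}. {..<f i})"
    by (auto intro: ccontr simp: not_less)
  then show "finite (boxes f)" "card (boxes f) = ysize f"
    using L by (simp_all add: ysize_eq[of L])
qed

text \<open>Entries grow along rows and columns, so the boxes with entries below a bound form a
  down-closed set. This turns such a set into a partition, for semistandard tableaux and later for
  domino tableaux.\<close>

lemma young_of_boxes:
  assumes fin: "finite S"
    and down: "\<And>i j i' j'. (i, j) \<in> S \<Longrightarrow> i' \<le> i \<Longrightarrow> j' \<le> j \<Longrightarrow> (i', j') \<in> S"
  shows "\<exists>f. young f \<and> boxes f = S"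
proof -
  define f where "f i = card {j. (i, j) \<in> S}" for i
  have fin_row: "finite {j. (i, j) \<in> S}" for i
    using finite_imageI[OF fin, of snd] by (rule finite_subset[rotated]) force
  have row: "{j. (i, j) \<in> S} = {..<f i}" for i
  proof (cases "{j. (i, j) \<in> S} = {}")
    case False
    define M where "M = Max {j. (i, j) \<in> S}"
    have "(i, M) \<in> S"
      using Max_in[OF fin_row False] by (simp add: M_def)
    then have "{j. (i, j) \<in> S} = {..M}"
      using Max_ge[OF fin_row[of i]] by (auto simp: M_def intro: down)
    then show ?thesis
      by (simp add: f_def lessThan_Suc_atMost)
  qed (simp add: f_def)
  have mem: "(i, j) \<in> S \<longleftrightarrow> j < f i" for i j
    using row[of i] by blast
  have "finite {i. f i \<noteq> 0}"
    using finite_imageI[OF fin, of fst]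
  proof (rule finite_subset[rotated], intro subsetI)
    fix i assume "i \<in> {i. f i \<noteq> 0}"
    then have "(i, 0) \<in> S" by (simp add: mem)
    then show "i \<in> fst ` S" by (metis fst_conv imageI)
  qed
  moreover have "f (Suc i) \<le> f i" for i
  proof (rule ccontr)
    assume "\<not> ?thesis"
    then have "(Suc i, f i) \<in> S" by (simp add: mem)
    then have "(i, f i) \<in> S" by (rule down) auto
    then show False by (simp add: mem)
  qed
  ultimately have "young f"
    by (simp add: young_def antimono_iff_le_Suc)
  then show ?thesis
    using mem by (intro exI[of _ f]) auto
qed

text \<open>The chain \<open>g (Suc i) \<le> f (Suc i) \<le> g i \<le> f i\<close> makes both
  functions decreasing, and it gives \<open>f\<close> at most one row more than
  \<open>g\<close>.\<close>

lemma interlace_young: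
  assumes "interlace g f"
  shows "young g \<longleftrightarrow> young f"
proof
  assume "young g"
  then obtain L where "\<And>i. L \<le> i \<Longrightarrow> g i = 0" using young_bound by blast
  then show "young f"
    using assms unfolding interlace_def
    by (intro youngI[of f "Suc L"]) (metis order_trans, metis Suc_le_D Suc_le_mono le_zero_eq)
next
  assume "young f"
  then obtain L where "\<And>i. L \<le> i \<Longrightarrow> f i = 0" using young_bound by blast
  then show "young g"
    using assms unfolding interlace_def
    by (intro youngI[of g "L"]) (metis order_trans, metis le_zero_eq)
qed

lemma interlace_ysize_le:
  assumes "interlace g f" "young f"
  shows "ysize g \<le> ysize f"
  using assms by (intro ysize_mono) (auto simp: interlace_def)

lemma finite_interlace_below: "young f \<Longrightarrow> finite {g. interlace g f}"
  by (rule finite_subset[OF _ finite_young_size[of "ysize f"]])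
    (auto simp: interlace_young interlace_ysize_le)

lemma young_parts:
  "bij_betw part (partitions n) {f. young f \<and> ysize f = n}"
  unfolding bij_betw_def
proof (intro conjI set_eqI iffI inj_onI)
  fix \<mu> \<nu> assume *: "\<mu> \<in> partitions n" "\<nu> \<in> partitions n" "part \<mu> = part \<nu>"
  have "{..<length \<mu>} = {i. part \<mu> i \<noteq> 0}" if "\<mu> \<in> partitions n" for \<mu>
  proof -
    have "\<mu> ! i \<noteq> 0" if "i < length \<mu>" for i
      using \<open>\<mu> \<in> partitions n\<close> nth_mem[OF that] by (metis (mono_tags, lifting) mem_Collect_eq partitions_def)
    then show ?thesis
      by (auto simp: part_def split: if_splits)
  qed
  then have "{..<length \<mu>} = {..<length \<nu>}"
    using * by simp
  then have "length \<mu> = length \<nu>"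
    by simp
  then show "\<mu> = \<nu>"
  proof (rule nth_equalityI)
    fix i assume "i < length \<mu>"
    then show "\<mu> ! i = \<nu> ! i"
      using fun_cong[OF *(3), of i] \<open>length \<mu> = length \<nu>\<close> by (simp add: part_def)
  qed
next
  fix f assume "f \<in> part ` partitions n"
  then obtain \<mu> where \<mu>: "\<mu> \<in> partitions n" and f: "f = part \<mu>" by blast
  have "young f"
    using \<mu> unfolding f
    by (intro youngI[of _ "length \<mu>"]) (auto simp: part_def partitions_def sorted_wrt_iff_nth_less)
  moreover have "ysize f = n"
    using \<mu> unfolding f
    by (subst ysize_eq[of "length \<mu>"])
      (auto simp: part_def partitions_def sum_list_sum_nth atLeast0LessThan)
  ultimately show "f \<in> {f. young f \<and> ysize f = n}" by simp
next
  fix f assume "f \<in> {f. young f \<and> ysize f = n}"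
  then have f: "young f" "ysize f = n" by auto
  define L where "L = (LEAST L. f L = 0)"
  have "f L = 0"
    unfolding L_def by (rule LeastI[of _ "ysize f"]) (simp add: young_support f)
  then have 0: "f i = 0" if "L \<le> i" for i
    using youngD[OF f(1) that] by simp
  have nz: "f i \<noteq> 0" if "i < L" for i
    using that not_less_Least unfolding L_def by blast
  have "part (map f [0..<L]) = f"
    using 0 by (auto simp: part_def)
  moreover have "map f [0..<L] \<in> partitions n"
    using youngD[OF f(1)] ysize_eq[of L f] f(2)
    by (auto simp: partitions_def sum_list_sum_nth sorted_wrt_iff_nth_less atLeast0LessThan 0 dest: nz)
  ultimately show "f \<in> part ` partitions n"
    by (metis imageI)
qed

lemma diagram_boxes: "diagram \<mu> = boxes (part \<mu>)"
  by (simp add: diagram_def boxes_def)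

section \<open>Tableaux and Kostka numbers\<close>

definition ssyt :: "(nat \<times> nat) set \<Rightarrow> (nat \<times> nat \<Rightarrow> nat) \<Rightarrow> bool" where
  "ssyt S T \<longleftrightarrow>
     (\<forall>i j j'. (i, j) \<in> S \<longrightarrow> (i, j') \<in> S \<longrightarrow> j < j' \<longrightarrow> T (i, j) \<le> T (i, j')) \<and>
     (\<forall>i i' j. (i, j) \<in> S \<longrightarrow> (i', j) \<in> S \<longrightarrow> i < i' \<longrightarrow> T (i, j) < T (i', j))"

definition content :: "(nat \<times> nat) set \<Rightarrow> (nat \<times> nat \<Rightarrow> nat) \<Rightarrow> nat \<Rightarrow> nat" where
  "content S T k = card {b \<in> S. T b = k}"

definition tableaux :: "nat \<Rightarrow> (nat \<Rightarrow> nat) \<Rightarrow> (nat \<times> nat \<Rightarrow> nat) set" where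
  "tableaux N f = {T \<in> boxes f \<rightarrow>\<^sub>E {..<N}. ssyt (boxes f) T}"

text \<open>The content is compared with \<open>c\<close> only below \<open>N\<close>, so the
  exponent vector of a monomial can serve as \<open>c\<close> and stay the same while an induction
  lowers \<open>N\<close>.\<close>

definition kostka :: "nat \<Rightarrow> (nat \<Rightarrow> nat) \<Rightarrow> (nat \<Rightarrow> nat) \<Rightarrow> nat" where
  "kostka N f c = card {T \<in> tableaux N f. \<forall>k<N. content (boxes f) T k = c k}"

lemma semistandard_ssyt: "semistandard \<mu> T \<longleftrightarrow> ssyt (boxes (part \<mu>)) T"
  by (simp add: semistandard_def ssyt_def diagram_boxes)

lemma finite_tableaux: "young f \<Longrightarrow> finite (tableaux N f)"
  by (rule finite_subset[of _ "boxes f \<rightarrow>\<^sub>E {..<N}"])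
    (auto simp: tableaux_def card_boxes intro!: finite_PiE)

lemma ssyt_row: "ssyt (boxes f) T \<Longrightarrow> j \<le> j' \<Longrightarrow> j' < f i \<Longrightarrow> T (i, j) \<le> T (i, j')"
  unfolding ssyt_def mem_boxes by (metis le_eq_less_or_eq le_less_trans)

lemma ssyt_column:
  "ssyt (boxes f) T \<Longrightarrow> young f \<Longrightarrow> i < i' \<Longrightarrow> j < f i' \<Longrightarrow> T (i, j) < T (i', j)"
  unfolding ssyt_def mem_boxes by (metis less_imp_le less_le_trans youngD)

lemma tableaux_less: "T \<in> tableaux N f \<Longrightarrow> b \<in> boxes f \<Longrightarrow> T b < N"
  unfolding tableaux_def by (blast dest: PiE_mem)

lemma tableaux_undefined: "T \<in> tableaux N f \<Longrightarrow> b \<notin> boxes f \<Longrightarrow> T b = undefined"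
  unfolding tableaux_def by (blast dest: PiE_arb)

lemma tableaux_ssyt: "T \<in> tableaux N f \<Longrightarrow> ssyt (boxes f) T"
  by (simp add: tableaux_def)

text \<open>The entry \<open>N\<close> is the largest and occurs at most once in a column. So a box
  with another one below it holds a smaller entry, which gives
  \<open>f (Suc i) \<le> g i\<close>.\<close>

lemma small_entries_interlace:
  assumes f: "young f" and T: "T \<in> tableaux (Suc N) f"
  shows "\<exists>g. interlace g f \<and> {b \<in> boxes f. T b < N} = boxes g"
proof -
  note row = ssyt_row[OF tableaux_ssyt[OF T]]
  note col = ssyt_column[OF tableaux_ssyt[OF T] f]
  have top: "T (i, j) \<le> N" if "j < f i" for i j
    using tableaux_less[OF T, of "(i, j)"] that by simp
  let ?S = "{b \<in> boxes f. T b < N}"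
  have "\<exists>g. young g \<and> boxes g = ?S"
  proof (rule young_of_boxes)
    show "finite ?S"
      using card_boxes(1)[OF f] by simp
    fix i j i' j' assume b: "(i, j) \<in> ?S" "i' \<le> i" "j' \<le> j"
    then have *: "j < f i" "T (i, j) < N" "j < f i'" "j' < f i'"
      using youngD[OF f, of i' i] by auto
    have "T (i', j') \<le> T (i', j)" using row * b by simp
    moreover have "T (i', j) \<le> T (i, j)" using col * b by (cases "i = i'") (auto intro: less_imp_le)
    ultimately show "(i', j') \<in> ?S" using * by auto
  qed
  then obtain g where g: "young g" "boxes g = ?S" by blast
  have mem: "j < g i \<longleftrightarrow> j < f i \<and> T (i, j) < N" for i j
    using g(2) mem_boxes[of i j g] by auto
  have "interlace g f"
    unfolding interlace_def
  proof (intro allI conjI)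
    fix i
    show "g i \<le> f i"
      using mem[of "f i" i] by (meson less_irrefl_nat not_le)
    show "f (Suc i) \<le> g i"
    proof (rule ccontr)
      assume "\<not> f (Suc i) \<le> g i"
      then have "g i < f (Suc i)" by simp
      then have "T (i, g i) < N" "g i < f i"
        using col[of i "Suc i" "g i"] top[of "g i" "Suc i"] youngD[OF f, of i "Suc i"] by auto
      then show False using mem[of "g i" i] by simp
    qed
  qed
  then show ?thesis using g by auto
qed

text \<open>Columns stay strict because of two boxes in a column of \<open>f\<close> the upper one
  lies in \<open>g\<close>: from \<open>i < i'\<close> and \<open>j < f i'\<close> follows
  \<open>j < f (Suc i) \<le> g i\<close>.\<close>

lemma tableaux_extend:
  assumes f: "young f" and g: "interlace g f" and T: "T \<in> tableaux N g"
  shows "(\<lambda>b\<in>boxes f. if b \<in> boxes g then T b else N) \<in> tableaux (Suc N) f" (is "?U \<in> _")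
proof -
  have yg: "young g" using f g interlace_young by blast
  have sub: "g i \<le> f i" "f (Suc i) \<le> g i" for i
    using g by (auto simp: interlace_def)
  have T_lt: "T (i, j) < N" if "j < g i" for i j
    using tableaux_less[OF T, of "(i, j)"] that by simp
  have "?U \<in> boxes f \<rightarrow>\<^sub>E {..<Suc N}"
    using T_lt by (auto simp: less_Suc_eq)
  moreover have "ssyt (boxes f) ?U"
    unfolding ssyt_def
  proof (intro conjI allI impI)
    fix i j j' assume "(i, j) \<in> boxes f" "(i, j') \<in> boxes f" "j < j'"
    then show "?U (i, j) \<le> ?U (i, j')"
      using ssyt_row[OF tableaux_ssyt[OF T], of j j' i] T_lt[of j i] by (auto simp: less_imp_le)
  next
    fix i i' j assume b: "(i, j) \<in> boxes f" "(i', j) \<in> boxes f" "i < i'"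
    then have "f i' \<le> f (Suc i)" using youngD[OF f] by simp
    then have "j < g i" using b sub[of i] by simp
    then show "?U (i, j) < ?U (i', j)"
      using ssyt_column[OF tableaux_ssyt[OF T] yg b(3), of j] T_lt[of j i] b by auto
  qed
  ultimately show ?thesis by (simp add: tableaux_def)
qed

lemma tableaux_restrict:
  assumes f: "young f" and g: "interlace g f" and T: "T \<in> tableaux (Suc N) f"
    and S: "{b \<in> boxes f. T b < N} = boxes g"
  shows "restrict T (boxes g) \<in> tableaux N g"
    and "content (boxes f) T = (content (boxes g) (restrict T (boxes g)))(N := ysize f - ysize g)"
proof -
  have yg: "young g" using f g interlace_young by blast
  have T_le: "T b \<le> N" if "b \<in> boxes f" for b
    using tableaux_less[OF T that] by simp
  have sub: "boxes g \<subseteq> boxes f" using S by auto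
  show "restrict T (boxes g) \<in> tableaux N g"
    using T S[symmetric] by (auto simp: tableaux_def ssyt_def)
  have "content (boxes f) T k =
      ((content (boxes g) (restrict T (boxes g)))(N := ysize f - ysize g)) k" for k
  proof (cases k N rule: linorder_cases)
    case less
    then have "{b \<in> boxes f. T b = k} = {b \<in> boxes g. T b = k}"
      using S by auto
    then show ?thesis using less by (auto simp: content_def intro: arg_cong[of _ _ card])
  next
    case equal
    have "{b \<in> boxes f. T b = N} = boxes f - boxes g"
      using S[symmetric] T_le by fastforce
    then show ?thesis
      using equal card_boxes[OF f] card_boxes[OF yg] sub by (simp add: content_def card_Diff_subset)
  next
    case greater
    then have "{b \<in> boxes f. T b = k} = {}" "{b \<in> boxes g. restrict T (boxes g) b = k} = {}"
      using T_le sub by fastforce+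
    then have "content (boxes f) T k = 0" "content (boxes g) (restrict T (boxes g)) k = 0"
      unfolding content_def by (simp_all only: card.empty)
    then show ?thesis using greater by simp
  qed
  then show "content (boxes f) T =
      (content (boxes g) (restrict T (boxes g)))(N := ysize f - ysize g)"
    by (rule ext)
qed

text \<open>Removing the boxes with the largest entry is a bijection onto the tableaux of all
  interlacing shapes. The predicate \<open>Q\<close> on contents is arbitrary because two kinds of
  counts need this recursion: Kostka numbers fix every multiplicity, symplectic tableaux only the
  sum of two consecutive ones.\<close>

lemma card_tableaux_Suc:
  assumes f: "young f"
  shows "card {T \<in> tableaux (Suc N) f. Q (content (boxes f) T)} =
    (\<Sum>g | interlace g f. card {T \<in> tableaux N g. Q ((content (boxes g) T)(N := ysize f - ysize g))})"
proof -
  define X where "X = {T \<in> tableaux (Suc N) f. Q (content (boxes f) T)}"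
  define Y where "Y g = {T \<in> X. {b \<in> boxes f. T b < N} = boxes g}" for g
  define Z where "Z g = {T \<in> tableaux N g. Q ((content (boxes g) T)(N := ysize f - ysize g))}" for g
  have "X = (\<Union>g\<in>{g. interlace g f}. Y g)"
    using small_entries_interlace[OF f] by (auto simp: X_def Y_def)
  moreover have "finite (Y g)" for g
    using finite_tableaux[OF f] by (auto simp: X_def Y_def)
  moreover have "Y g \<inter> Y h = {}" if "g \<noteq> h" for g h
    using that boxes_inject[of g h] by (auto simp: Y_def)
  ultimately have "card X = (\<Sum>g | interlace g f. card (Y g))"
    by (simp add: card_UN_disjoint finite_interlace_below[OF f])
  also have "\<dots> = (\<Sum>g | interlace g f. card (Z g))"
  proof (rule sum.cong[OF refl])
    fix g assume "g \<in> {g. interlace g f}"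
    then have g: "interlace g f" by simp
    have sub: "boxes g \<subseteq> boxes f"
      using g unfolding interlace_def by (clarsimp simp: boxes_def) (meson less_le_trans)
    let ?r = "\<lambda>T. restrict T (boxes g)"
    let ?e = "\<lambda>T. \<lambda>b\<in>boxes f. if b \<in> boxes g then T b else N"
    have "bij_betw ?r (Y g) (Z g)"
    proof (rule bij_betw_byWitness[of _ ?e])
      show "\<forall>T\<in>Y g. ?e (?r T) = T"
      proof (rule ballI, rule ext)
        fix T b assume T: "T \<in> Y g"
        then have "T \<in> tableaux (Suc N) f" "b \<in> boxes g \<longleftrightarrow> b \<in> boxes f \<and> T b < N"
          by (auto simp: Y_def X_def)
        then show "?e (?r T) b = T b"
          using tableaux_less[of T "Suc N" f b] tableaux_undefined[of T "Suc N" f b]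
          by (cases "b \<in> boxes f") auto
      qed
      have re: "?r (?e T) = T" if "T \<in> tableaux N g" for T
      proof (rule ext)
        fix b
        show "?r (?e T) b = T b"
          using sub tableaux_undefined[OF that, of b] by (cases "b \<in> boxes g") auto
      qed
      then show "\<forall>T\<in>Z g. ?r (?e T) = T" by (auto simp: Z_def)
      show "?r ` Y g \<subseteq> Z g"
        using tableaux_restrict[OF f g] by (auto simp: X_def Y_def Z_def)
      show "?e ` Z g \<subseteq> Y g"
      proof clarify
        fix T assume T: "T \<in> Z g"
        then have T': "T \<in> tableaux N g" by (simp add: Z_def)
        have U: "?e T \<in> tableaux (Suc N) f"
          using tableaux_extend[OF f g T'] .
        have "T b < N" if "b \<in> boxes g" for b
          using tableaux_less[OF T' that] .
        then have S: "{b \<in> boxes f. ?e T b < N} = boxes g"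
          using sub by auto
        show "?e T \<in> Y g"
          using U S T
          unfolding X_def Y_def Z_def mem_Collect_eq tableaux_restrict(2)[OF f g U S] re[OF T']
          by blast
      qed
    qed
    then show "card (Y g) = card (Z g)" by (rule bij_betw_same_card)
  qed
  finally show ?thesis by (simp add: X_def Z_def)
qed

lemma kostka_Suc:
  assumes f: "young f"
  shows "kostka (Suc N) f c = (\<Sum>g | interlace g f \<and> ysize f = ysize g + c N. kostka N g c)"
proof -
  have "kostka (Suc N) f c = (\<Sum>g | interlace g f. card {T \<in> tableaux N g.
      \<forall>k<Suc N. ((content (boxes g) T)(N := ysize f - ysize g)) k = c k})"
    unfolding kostka_def using card_tableaux_Suc[OF f, of N "\<lambda>t. \<forall>k<Suc N. t k = c k"] by simp
  also have "\<dots> = (\<Sum>g | interlace g f. if ysize f = ysize g + c N then kostka N g c else 0)"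
  proof (rule sum.cong[OF refl])
    fix g assume "g \<in> {g. interlace g f}"
    then have "ysize g \<le> ysize f" using interlace_ysize_le[OF _ f] by simp
    then have "(\<forall>k<Suc N. (t(N := ysize f - ysize g)) k = c k) \<longleftrightarrow>
        ysize f = ysize g + c N \<and> (\<forall>k<N. t k = c k)" for t
      by (auto simp: less_Suc_eq)
    then show "card {T \<in> tableaux N g.
        \<forall>k<Suc N. ((content (boxes g) T)(N := ysize f - ysize g)) k = c k} =
        (if ysize f = ysize g + c N then kostka N g c else 0)"
      by (simp add: kostka_def)
  qed
  also have "\<dots> = (\<Sum>g\<in>{g. interlace g f} \<inter> {g. ysize f = ysize g + c N}. kostka N g c)"
    using finite_interlace_below[OF f] by (simp add: sum.inter_restrict)
  finally show ?thesis by (simp add: Int_def)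
qed

lemma kostka_cong: "(\<And>k. k < N \<Longrightarrow> c k = d k) \<Longrightarrow> kostka N f c = kostka N f d"
  by (simp add: kostka_def cong: conj_cong)

lemma kostka_0:
  assumes "young f"
  shows "kostka 0 f c = (if ysize f = 0 then 1 else 0)"
proof (cases "ysize f = 0")
  case True
  then have "boxes f = {}" using card_boxes[OF assms] by simp
  then show ?thesis using True by (simp add: kostka_def tableaux_def ssyt_def)
next
  case False
  then have "boxes f \<noteq> {}" using card_boxes[OF assms] by auto
  then have "tableaux 0 f = {}" by (auto simp: tableaux_def PiE_eq_empty_iff)
  then show ?thesis using False by (simp add: kostka_def)
qed

section \<open>One-row shapes and the coefficients of Schur functions\<close>

definition row_shape :: "nat \<Rightarrow> nat \<Rightarrow> nat" where
  "row_shape k i = (if i = 0 then k else 0)"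

lemma young_row_shape: "young (row_shape k)"
  by (rule youngI[of _ 1]) (auto simp: row_shape_def)

lemma ysize_row_shape [simp]: "ysize (row_shape k) = k"
  by (subst ysize_eq[of 1]) (auto simp: row_shape_def)

lemma part_singleton: "part [k] = row_shape k"
  by (auto simp: part_def row_shape_def)

lemma interlace_row_shape: "interlace g (row_shape k) \<longleftrightarrow> (\<exists>j\<le>k. g = row_shape j)"
proof
  assume g: "interlace g (row_shape k)"
  have "g i = row_shape (g 0) i" for i
    using g by (cases i) (auto simp: interlace_def row_shape_def dest: spec[of _ i])
  moreover have "g 0 \<le> k"
    using g by (metis interlace_def row_shape_def)
  ultimately show "\<exists>j\<le>k. g = row_shape j" by blast
qed (auto simp: interlace_def row_shape_def)

text \<open>A one-row tableau is its content written in increasing order, so every monomial of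
  degree \<open>k\<close> has coefficient 1 and \<open>schurf (row_shape k)\<close> is the complete
  homogeneous function. In the recursion, removing the largest entries leaves only the row of length
  \<open>k - c N\<close>.\<close>

lemma kostka_row_shape: "kostka N (row_shape k) c = (if (\<Sum>i<N. c i) = k then 1 else 0)"
proof (induction N arbitrary: k)
  case 0
  show ?case by (simp add: kostka_0 young_row_shape)
next
  case (Suc N)
  have "{g. interlace g (row_shape k) \<and> ysize (row_shape k) = ysize g + c N} =
      (if c N \<le> k then {row_shape (k - c N)} else {})"
    by (auto simp: interlace_row_shape intro!: exI[of _ "k - c N"])
  then show ?case
    by (auto simp: kostka_Suc young_row_shape Suc.IH)
qed

definition schurf :: "(nat \<Rightarrow> nat) \<Rightarrow> mfps" where
  "schurf f = Abs_mfps (\<lambda>u. int (card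
     {T \<in> boxes f \<rightarrow>\<^sub>E UNIV. ssyt (boxes f) T \<and> content (boxes f) T = Poly_Mapping.lookup u}))"

lemma schur_schurf: "schur \<mu> = schurf (part \<mu>)"
  by (simp add: schur_def schurf_def diagram_boxes semistandard_ssyt content_def fun_eq_iff)

text \<open>A tableau whose content is \<open>u\<close> has no entry outside the support of
  \<open>u\<close>, so bounding the entries by \<open>N\<close> loses nothing. This is the passage
  from infinitely many variables to \<open>N\<close>.\<close>

lemma mcoeff_schurf:
  assumes f: "young f" and u: "\<And>k. N \<le> k \<Longrightarrow> Poly_Mapping.lookup u k = 0"
  shows "mcoeff (schurf f) u = int (kostka N f (Poly_Mapping.lookup u))"
proof -
  have "T b < N" if "content (boxes f) T = Poly_Mapping.lookup u" "b \<in> boxes f" for T b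
  proof (rule ccontr)
    assume "\<not> T b < N"
    then have "card {b' \<in> boxes f. T b' = T b} = 0"
      using u fun_cong[OF that(1), of "T b"] by (simp add: content_def)
    then have "{b' \<in> boxes f. T b' = T b} = {}" using card_boxes(1)[OF f] by simp
    then show False using that(2) by blast
  qed
  moreover have "content (boxes f) T k = Poly_Mapping.lookup u k"
    if "T \<in> tableaux N f" "N \<le> k" for T k
  proof -
    have "{b \<in> boxes f. T b = k} = {}"
      using that tableaux_less[of T N f] by fastforce
    then have "content (boxes f) T k = 0"
      unfolding content_def by (simp only: card.empty)
    then show ?thesis using u that(2) by simp
  qed
  ultimately have "{T \<in> boxes f \<rightarrow>\<^sub>E UNIV. ssyt (boxes f) T \<and> content (boxes f) T = Poly_Mapping.lookup u}
      = {T \<in> tableaux N f. \<forall>k<N. content (boxes f) T k = Poly_Mapping.lookup u k}"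
    by (auto simp: tableaux_def fun_eq_iff PiE_def Pi_def) (metis linorder_not_le)
  then show ?thesis
    by (simp add: schurf_def kostka_def Abs_mfps_inverse)
qed

section \<open>Pieri's rule\<close>

definition hstrip :: "nat \<Rightarrow> (nat \<Rightarrow> nat) \<Rightarrow> (nat \<Rightarrow> nat) \<Rightarrow> bool" where
  "hstrip k g f \<longleftrightarrow> interlace g f \<and> young g \<and> ysize f = ysize g + k"

lemma hstrip_young: "hstrip k g f \<Longrightarrow> young g \<and> young f"
  by (auto simp: hstrip_def interlace_young)

lemma hstrip_size: "hstrip k g f \<Longrightarrow> ysize f = ysize g + k"
  by (simp add: hstrip_def)

lemma kostka_Suc_hstrip:
  assumes "young f"
  shows "kostka (Suc N) f c = (\<Sum>g | hstrip (c N) g f. kostka N g c)"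
  unfolding kostka_Suc[OF assms] using assms
  by (intro sum.cong) (auto simp: hstrip_def interlace_young)

lemma finite_hstrip_above: "finite {f. hstrip k g f}"
  by (rule finite_subset[OF _ finite_young_size[of "ysize g + k"]])
    (auto simp: hstrip_young hstrip_size)

lemma finite_hstrip_below: "finite {g. hstrip k g f}"
  by (rule finite_subset[OF _ finite_young_size[of "ysize f"]])
    (auto simp: hstrip_young hstrip_size)

text \<open>
  When \<open>e\<close> lies below and \<open>f\<close> above both \<open>g\<close> and \<open>h\<close>, then \<open>f (Suc i)\<close> and \<open>e i\<close> range over the same
  interval, and reflecting it exchanges \<open>f\<close> and \<open>e\<close>; \<open>f 0\<close> is the only remaining freedom.
\<close>

definition reflect_down :: "(nat \<Rightarrow> nat) \<Rightarrow> (nat \<Rightarrow> nat) \<Rightarrow> (nat \<Rightarrow> nat) \<Rightarrow> nat \<Rightarrow> nat" where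
  "reflect_down g h f i = max (g (Suc i)) (h (Suc i)) + min (g i) (h i) - f (Suc i)"

definition reflect_up :: "(nat \<Rightarrow> nat) \<Rightarrow> (nat \<Rightarrow> nat) \<Rightarrow> nat \<Rightarrow> (nat \<Rightarrow> nat) \<Rightarrow> nat \<Rightarrow> nat" where
  "reflect_up g h p e i = (case i of 0 \<Rightarrow> max (g 0) (h 0) + p
     | Suc i \<Rightarrow> max (g (Suc i)) (h (Suc i)) + min (g i) (h i) - e i)"

lemma interlace_both_above:
  "interlace g f \<and> interlace h f \<longleftrightarrow> max (g 0) (h 0) \<le> f 0 \<and>
     (\<forall>i. max (g (Suc i)) (h (Suc i)) \<le> f (Suc i) \<and> f (Suc i) \<le> min (g i) (h i))"
proof -
  from all_nat_iff[of "\<lambda>i. g i \<le> f i \<and> h i \<le> f i"] show ?thesis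
    unfolding interlace_def by auto
qed

lemma interlace_both_below:
  "interlace e g \<and> interlace e h \<longleftrightarrow>
     (\<forall>i. max (g (Suc i)) (h (Suc i)) \<le> e i \<and> e i \<le> min (g i) (h i))"
  unfolding interlace_def by auto

text \<open>In each row max and min of \<open>g\<close> and \<open>h\<close> add up to
  \<open>g i + h i\<close>. With |f| = |g| + k = |h| + j this yields |g| - |e| = j - p and |h| - |e|
  = k - p, the strip sizes of the exchange.\<close>

lemma ysize_reflect:
  assumes g: "young g" and h: "young h"
    and f0: "f 0 = max (g 0) (h 0) + p"
    and f: "\<And>i. f (Suc i) + e i = max (g (Suc i)) (h (Suc i)) + min (g i) (h i)"
  shows "ysize f + ysize e = ysize g + ysize h + p"
proof -
  obtain L where L: "\<And>i. L \<le> i \<Longrightarrow> g i = 0" using young_bound[OF g] by blast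
  obtain M where M: "\<And>i. M \<le> i \<Longrightarrow> h i = 0" using young_bound[OF h] by blast
  define K where "K = Suc (L + M)"
  have 0: "g i = 0" "h i = 0" if "K \<le> Suc i" for i
    using that L M by (auto simp: K_def)
  have f_0: "f i = 0" if "Suc K \<le> i" for i
    using that f[of "i - 1"] 0[of i] 0[of "i - 1"] by simp
  have e_0: "e i = 0" if "K \<le> i" for i
    using that f[of i] 0[of i] 0[of "Suc i"] by simp
  have "ysize f + ysize e = f 0 + (\<Sum>i<K. f (Suc i) + e i)"
    using ysize_eq[of "Suc K" f] ysize_eq[of K e] f_0 e_0
    by (simp add: sum.lessThan_Suc_shift sum.distrib del: sum.lessThan_Suc)
  also have "\<dots> = p + (\<Sum>i<Suc K. max (g i) (h i)) + (\<Sum>i<K. min (g i) (h i))"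
    by (simp add: f f0 sum.lessThan_Suc_shift sum.distrib del: sum.lessThan_Suc)
  also have "\<dots> = p + (\<Sum>i<K. max (g i) (h i) + min (g i) (h i))"
    using 0[of K] by (simp add: sum.distrib)
  also have "(\<Sum>i<K. max (g i) (h i) + min (g i) (h i)) = (\<Sum>i<K. g i + h i)"
    by (rule sum.cong) auto
  also have "\<dots> = ysize g + ysize h"
    using ysize_eq[of K g] ysize_eq[of K h] 0 by (simp add: sum.distrib)
  finally show ?thesis by simp
qed

text \<open>This is the commutation relation between adding and removing horizontal strips. The
  number \<open>p\<close> is the overhang of the first row of \<open>f\<close> beyond
  \<open>g\<close> and \<open>h\<close>, for which \<open>e\<close> has no counterpart; in
  generating functions the sum over \<open>p\<close> is the factor 1/(1 - xy).\<close>

lemma card_hstrip_commute: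
  assumes g: "young g" and h: "young h"
  shows "card {f. hstrip k g f \<and> hstrip j h f} =
    (\<Sum>p\<le>min k j. card {e. hstrip (j - p) e g \<and> hstrip (k - p) e h})"
proof -
  let ?F = "{f. hstrip k g f \<and> hstrip j h f}"
  let ?E = "\<lambda>p. {e. hstrip (j - p) e g \<and> hstrip (k - p) e h}"
  have "bij_betw (\<lambda>f. (f 0 - max (g 0) (h 0), reflect_down g h f)) ?F (SIGMA p:{..min k j}. ?E p)"
  proof (rule bij_betw_byWitness[of _ "\<lambda>(p, e). reflect_up g h p e"])
    show "\<forall>f\<in>?F. (\<lambda>(p, e). reflect_up g h p e) (f 0 - max (g 0) (h 0), reflect_down g h f) = f"
    proof (rule ballI, rule ext)
      fix f i assume "f \<in> ?F"
      then have "interlace g f \<and> interlace h f" by (simp add: hstrip_def)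
      then have "max (g 0) (h 0) \<le> f 0"
        and "f (Suc i) \<le> max (g (Suc i)) (h (Suc i)) + min (g i) (h i)" for i
        unfolding interlace_both_above by (auto intro: trans_le_add2)
      then show "(\<lambda>(p, e). reflect_up g h p e) (f 0 - max (g 0) (h 0), reflect_down g h f) i = f i"
        by (cases i) (simp_all only: reflect_up_def reflect_down_def prod.case nat.case
            diff_diff_cancel le_add_diff_inverse)
    qed
    show "\<forall>pe\<in>SIGMA p:{..min k j}. ?E p.
        (\<lambda>f. (f 0 - max (g 0) (h 0), reflect_down g h f)) ((\<lambda>(p, e). reflect_up g h p e) pe) = pe"
    proof clarify
      fix p e assume "hstrip (j - p) e g" "hstrip (k - p) e h"
      then have "interlace e g \<and> interlace e h" by (simp add: hstrip_def)
      then have "max (g (Suc i)) (h (Suc i)) \<le> e i \<and> e i \<le> min (g i) (h i)" for i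
        unfolding interlace_both_below by blast
      then have "e i \<le> max (g (Suc i)) (h (Suc i)) + min (g i) (h i)" for i
        by (meson trans_le_add2)
      then have "max (g (Suc i)) (h (Suc i)) + min (g i) (h i) -
          (max (g (Suc i)) (h (Suc i)) + min (g i) (h i) - e i) = e i" for i
        by (rule diff_diff_cancel)
      then show "reflect_up g h p e 0 - max (g 0) (h 0) = p \<and>
          reflect_down g h (reflect_up g h p e) = e"
        by (simp add: reflect_up_def reflect_down_def fun_eq_iff del: max_less_iff_conj)
    qed
    show "(\<lambda>f. (f 0 - max (g 0) (h 0), reflect_down g h f)) ` ?F \<subseteq> (SIGMA p:{..min k j}. ?E p)"
    proof (rule image_subsetI)
      fix f assume "f \<in> ?F"
      then have f: "hstrip k g f" "hstrip j h f" by auto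
      define p where "p = f 0 - max (g 0) (h 0)"
      define e where "e = reflect_down g h f"
      have ab: "max (g 0) (h 0) \<le> f 0"
        "max (g (Suc i)) (h (Suc i)) \<le> f (Suc i)" "f (Suc i) \<le> min (g i) (h i)" for i
        using f interlace_both_above[of g f h] by (auto simp: hstrip_def)
      have "f (Suc i) + e i = max (g (Suc i)) (h (Suc i)) + min (g i) (h i)" for i
        using ab(3)[of i] unfolding e_def reflect_down_def by linarith
      moreover have "f 0 = max (g 0) (h 0) + p"
        using ab(1) by (simp add: p_def)
      ultimately have size: "ysize f + ysize e = ysize g + ysize h + p"
        using ysize_reflect[OF g h] by blast
      have "max (g (Suc i)) (h (Suc i)) \<le> e i \<and> e i \<le> min (g i) (h i)" for i
        using ab(2)[of i] ab(3)[of i] unfolding e_def reflect_down_def by linarith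
      then have e: "interlace e g" "interlace e h"
        using interlace_both_below by blast+
      \<comment> \<open>The size relation makes |g| - |e| = j - p and |h| - |e| = k - p; since
        neither is negative, \<open>p \<le> min k j\<close>.\<close>
      then have "young e" "ysize e \<le> ysize g" "ysize e \<le> ysize h"
        using g h interlace_young interlace_ysize_le by blast+
      then show "(f 0 - max (g 0) (h 0), reflect_down g h f) \<in> (SIGMA p:{..min k j}. ?E p)"
        using e size hstrip_size[OF f(1)] hstrip_size[OF f(2)]
        unfolding p_def[symmetric] e_def[symmetric] by (auto simp: hstrip_def)
    qed
    show "(\<lambda>(p, e). reflect_up g h p e) ` (SIGMA p:{..min k j}. ?E p) \<subseteq> ?F"
    proof (rule image_subsetI)
      fix pe assume "pe \<in> (SIGMA p:{..min k j}. ?E p)"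
      then obtain p e where pe: "pe = (p, e)" and p: "p \<le> min k j"
        and e: "hstrip (j - p) e g" "hstrip (k - p) e h" by auto
      define f where "f = reflect_up g h p e"
      have be: "max (g (Suc i)) (h (Suc i)) \<le> e i" "e i \<le> min (g i) (h i)" for i
        using e interlace_both_below[of e g h] by (auto simp: hstrip_def)
      have sum: "f (Suc i) + e i = max (g (Suc i)) (h (Suc i)) + min (g i) (h i)" for i
        using be(2)[of i] unfolding f_def reflect_up_def nat.case by linarith
      have f0: "f 0 = max (g 0) (h 0) + p"
        by (simp add: f_def reflect_up_def)
      have size: "ysize f + ysize e = ysize g + ysize h + p"
        using ysize_reflect[OF g h f0 sum] .
      have "max (g (Suc i)) (h (Suc i)) \<le> f (Suc i) \<and> f (Suc i) \<le> min (g i) (h i)" for i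
        using be(1)[of i] be(2)[of i] sum[of i] by linarith
      then have "interlace g f" "interlace h f"
        using f0 interlace_both_above[of g f h] by auto
      then show "(\<lambda>(p, e). reflect_up g h p e) pe \<in> ?F"
        using g h p size hstrip_size[OF e(1)] hstrip_size[OF e(2)]
        unfolding pe prod.case f_def[symmetric] by (auto simp: hstrip_def)
    qed
  qed
  then have "card ?F = card (SIGMA p:{..min k j}. ?E p)"
    by (rule bij_betw_same_card)
  also have "\<dots> = (\<Sum>p\<le>min k j. card (?E p))"
    by (rule card_SigmaI) (auto intro: finite_subset[OF _ finite_hstrip_below])
  finally show ?thesis .
qed

text \<open>These are the exponent vectors of the monomials of degree \<open>k\<close> in the first
  \<open>N\<close> variables that divide \<open>x^c\<close>: the possible contributions of a one-row
  factor. Vanishing from \<open>N\<close> on makes each monomial appear once.\<close>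

definition subcontents :: "nat \<Rightarrow> nat \<Rightarrow> (nat \<Rightarrow> nat) \<Rightarrow> (nat \<Rightarrow> nat) set" where
  "subcontents N k c = {a. (\<forall>i. a i \<le> c i) \<and> (\<forall>i\<ge>N. a i = 0) \<and> (\<Sum>i<N. a i) = k}"

lemma finite_subcontents: "finite (subcontents N k c)"
proof (rule finite_subset)
  show "subcontents N k c \<subseteq>
      {a. \<forall>i. (i \<in> {..<N} \<longrightarrow> a i \<in> {..k}) \<and> (i \<notin> {..<N} \<longrightarrow> a i = 0)}"
    by (auto simp: subcontents_def intro: member_le_sum)
  show "finite \<dots>"
    by (rule finite_set_of_finite_funs) auto
qed

lemma sum_subcontents_Suc:
  "(\<Sum>a\<in>subcontents (Suc N) k c. F a) =
    (\<Sum>p\<le>min k (c N). \<Sum>a\<in>subcontents N (k - p) c. F (a(N := p)))"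
proof -
  have "(\<Sum>p\<le>min k (c N). \<Sum>a\<in>subcontents N (k - p) c. F (a(N := p))) =
      (\<Sum>(p, a)\<in>(SIGMA p:{..min k (c N)}. subcontents N (k - p) c). F (a(N := p)))"
    by (subst sum.Sigma) (auto simp: finite_subcontents)
  also have "\<dots> = (\<Sum>a\<in>subcontents (Suc N) k c. F a)"
    by (rule sum.reindex_bij_witness[where i = "\<lambda>a. (a N, a(N := 0))" and j = "\<lambda>(p, a). a(N := p)"])
      (auto simp: subcontents_def fun_eq_iff)
  finally show ?thesis by simp
qed

text \<open>Both sides are the coefficient of \<open>x^c\<close> in Pieri's rule with
  \<open>N\<close> variables. Taking the largest entries off a tableau of shape \<open>f\<close>
  leaves some \<open>h\<close>; the commutation of strips replaces \<open>f\<close>, above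
  \<open>g\<close> and \<open>h\<close>, by \<open>e\<close> below both; the induction hypothesis at
  \<open>e\<close> with \<open>k - p\<close> then carries out the sum over \<open>h\<close>. The
  overhang \<open>p\<close> becomes the exponent of the last variable in the one-row factor.\<close>

lemma pieri_kostka:
  assumes "young g"
  shows "(\<Sum>f | hstrip k g f. kostka N f c) = (\<Sum>a\<in>subcontents N k c. kostka N g (\<lambda>i. c i - a i))"
  using assms
proof (induction N arbitrary: g k)
  case 0
  have "(\<Sum>f | hstrip k g f. kostka 0 f c) = (\<Sum>f | hstrip k g f. if ysize g + k = 0 then 1 else 0)"
    by (rule sum.cong) (auto simp: kostka_0 hstrip_young hstrip_size)
  also have "\<dots> = (if k = 0 then (if ysize g = 0 then 1 else 0) else 0)"
  proof (cases "ysize g + k = 0")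
    case True
    then have g: "g i = 0" for i
      using young_le_ysize[OF 0, of i] by simp
    have "f = g" if "hstrip k g f" for f
      using young_le_ysize[of f] hstrip_young[OF that] hstrip_size[OF that] True g by auto
    moreover have "interlace g g"
      by (simp add: interlace_def g)
    then have "hstrip k g g"
      using "0.prems" True by (simp add: hstrip_def)
    ultimately have "{f. hstrip k g f} = {g}" by auto
    then show ?thesis using True by simp
  qed auto
  also have "\<dots> = (\<Sum>a\<in>(if k = 0 then {\<lambda>_. 0} else {}). kostka 0 g (\<lambda>i. c i - a i))"
    by (simp add: kostka_0 0)
  also have "(if k = 0 then {\<lambda>_. 0} else {}) = subcontents 0 k c"
    by (auto simp: subcontents_def)
  finally show ?case .
next
  case (Suc N)
  \<comment> \<open>A finite set that contains every \<open>h\<close> below some \<open>f\<close>,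
    since |h| \<le> |f| = |g| + k; the interchanges of sums below need one range for
    \<open>h\<close> independent of \<open>f\<close>.\<close>
  define V where "V = {h. young h \<and> ysize h \<le> ysize g + k}"
  have V: "finite V" unfolding V_def by (rule finite_young_size)
  have "(\<Sum>f | hstrip k g f. kostka (Suc N) f c) =
      (\<Sum>f | hstrip k g f. \<Sum>h | h \<in> V \<and> hstrip (c N) h f. kostka N h c)"
  proof (rule sum.cong[OF refl])
    fix f assume "f \<in> {f. hstrip k g f}"
    then have "young f" "ysize f = ysize g + k" using hstrip_young hstrip_size by auto
    then show "kostka (Suc N) f c = (\<Sum>h | h \<in> V \<and> hstrip (c N) h f. kostka N h c)"
      unfolding kostka_Suc_hstrip[OF \<open>young f\<close>]
      by (intro sum.cong) (auto simp: V_def dest: hstrip_young hstrip_size)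
  qed
  also have "\<dots> = (\<Sum>h\<in>V. \<Sum>f | f \<in> {f. hstrip k g f} \<and> hstrip (c N) h f. kostka N h c)"
    by (rule sum.swap_restrict[OF finite_hstrip_above V])
  also have "\<dots> = (\<Sum>h\<in>V. card {f. hstrip k g f \<and> hstrip (c N) h f} * kostka N h c)"
    by simp
  also have "\<dots> = (\<Sum>h\<in>V. \<Sum>p\<le>min k (c N). \<Sum>e | e \<in> {e. hstrip (c N - p) e g} \<and> hstrip (k - p) e h. kostka N h c)"
    by (rule sum.cong[OF refl]) (simp add: card_hstrip_commute Suc.prems V_def sum_distrib_right)
  also have "\<dots> = (\<Sum>p\<le>min k (c N). \<Sum>h\<in>V. \<Sum>e | e \<in> {e. hstrip (c N - p) e g} \<and> hstrip (k - p) e h. kostka N h c)"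
    by (rule sum.swap)
  also have "\<dots> = (\<Sum>p\<le>min k (c N). \<Sum>e | hstrip (c N - p) e g. \<Sum>h | h \<in> V \<and> hstrip (k - p) e h. kostka N h c)"
    by (rule sum.cong[OF refl], subst sum.swap_restrict[OF V finite_hstrip_below]) simp
  also have "\<dots> = (\<Sum>p\<le>min k (c N). \<Sum>e | hstrip (c N - p) e g.
      \<Sum>a\<in>subcontents N (k - p) c. kostka N e (\<lambda>i. c i - a i))"
  proof (rule sum.cong[OF refl], rule sum.cong[OF refl])
    fix p e assume "p \<in> {..min k (c N)}" "e \<in> {e. hstrip (c N - p) e g}"
    then have e: "young e" "ysize e \<le> ysize g" using hstrip_young hstrip_size by auto
    have "{h. h \<in> V \<and> hstrip (k - p) e h} = {h. hstrip (k - p) e h}"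
      using e by (auto simp: V_def dest: hstrip_young hstrip_size)
    then show "(\<Sum>h | h \<in> V \<and> hstrip (k - p) e h. kostka N h c) =
        (\<Sum>a\<in>subcontents N (k - p) c. kostka N e (\<lambda>i. c i - a i))"
      using Suc.IH[OF e(1)] by simp
  qed
  \<comment> \<open>The strips of size \<open>c N - p\<close> below \<open>g\<close> are the last
    step of a tableau of shape \<open>g\<close> whose content at \<open>N\<close> is that of
    \<open>c\<close> minus \<open>a(N := p)\<close>, so the sum over \<open>e\<close> is again a
    Kostka number of \<open>g\<close>.\<close>
  also have "\<dots> = (\<Sum>p\<le>min k (c N). \<Sum>a\<in>subcontents N (k - p) c.
      kostka (Suc N) g (\<lambda>i. c i - (a(N := p)) i))"
  proof (rule sum.cong[OF refl], subst sum.swap, rule sum.cong[OF refl])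
    fix p a
    show "(\<Sum>e | hstrip (c N - p) e g. kostka N e (\<lambda>i. c i - a i)) =
        kostka (Suc N) g (\<lambda>i. c i - (a(N := p)) i)"
      by (simp add: kostka_Suc_hstrip Suc.prems) (intro sum.cong refl kostka_cong, simp)
  qed
  also have "\<dots> = (\<Sum>a\<in>subcontents (Suc N) k c. kostka (Suc N) g (\<lambda>i. c i - a i))"
    by (simp add: sum_subcontents_Suc)
  finally show ?case .
qed

section \<open>Pieri's rule in the ring of power series\<close>

lemma mcoeff_sum: "mcoeff (sum F A) u = (\<Sum>x\<in>A. mcoeff (F x) u)"
  by (induction A rule: infinite_finite_induct) (auto simp: zero_mfps.rep_eq plus_mfps.rep_eq)

theorem pieri:
  assumes g: "young g"
  shows "schurf (row_shape k) * schurf g = (\<Sum>f | hstrip k g f. schurf f)"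
proof (rule mfps_eqI)
  fix u :: "nat \<Rightarrow>\<^sub>0 nat"
  obtain N where "\<forall>k\<in>Poly_Mapping.keys u. k < N"
    using finite_nat_set_iff_bounded finite_keys by blast
  then have u: "Poly_Mapping.lookup u i = 0" if "N \<le> i" for i
    using that by (meson in_keys_iff linorder_not_le)
  have ab: "Poly_Mapping.lookup a i = 0" "Poly_Mapping.lookup b i = 0"
    if "(a, b) \<in> splits u" "N \<le> i" for a b i
    using that u[of i] by (auto simp: splits_def lookup_add)
  let ?c = "Poly_Mapping.lookup u"
  have "mcoeff (schurf (row_shape k) * schurf g) u =
      (\<Sum>(a, b)\<in>splits u. if (\<Sum>i<N. Poly_Mapping.lookup a i) = k
         then int (kostka N g (Poly_Mapping.lookup b)) else 0)"
    unfolding times_mfps.rep_eq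
    by (rule sum.cong) (auto simp: mcoeff_schurf[where N = N] g young_row_shape ab kostka_row_shape)
  also have "\<dots> = (\<Sum>(a, b)\<in>{(a, b) \<in> splits u. (\<Sum>i<N. Poly_Mapping.lookup a i) = k}.
      int (kostka N g (Poly_Mapping.lookup b)))"
    by (rule sum.mono_neutral_cong_right) (auto simp: finite_splits split: if_splits)
  \<comment> \<open>In \<open>a + b = u\<close> the summand \<open>b\<close> is determined as
    \<open>?c - a\<close>, so what remains is the choice of \<open>a\<close>. Both functions vanish
    from \<open>N\<close> on, hence are genuine exponent vectors.\<close>
  also have "\<dots> = (\<Sum>a\<in>subcontents N k ?c. int (kostka N g (\<lambda>i. ?c i - a i)))"
  proof (rule sum.reindex_bij_witness[where j = "\<lambda>(a, b). Poly_Mapping.lookup a" and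
        i = "\<lambda>a. (Abs_poly_mapping a, Abs_poly_mapping (\<lambda>i. ?c i - a i))"])
    fix ab' assume "ab' \<in> {(a, b) \<in> splits u. (\<Sum>i<N. Poly_Mapping.lookup a i) = k}"
    then obtain a b where ab': "ab' = (a, b)" "(a, b) \<in> splits u"
      "(\<Sum>i<N. Poly_Mapping.lookup a i) = k" by auto
    then have c: "?c i = Poly_Mapping.lookup a i + Poly_Mapping.lookup b i" for i
      by (auto simp: splits_def lookup_add)
    show "(Abs_poly_mapping (case ab' of (a, b) \<Rightarrow> Poly_Mapping.lookup a),
        Abs_poly_mapping (\<lambda>i. ?c i - (case ab' of (a, b) \<Rightarrow> Poly_Mapping.lookup a) i)) = ab'"
      by (simp add: ab' c lookup_inverse)
    show "int (kostka N g (\<lambda>i. ?c i - (case ab' of (a, b) \<Rightarrow> Poly_Mapping.lookup a) i)) =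
        (case ab' of (a, b) \<Rightarrow> int (kostka N g (Poly_Mapping.lookup b)))"
      by (simp add: ab' c)
    show "(case ab' of (a, b) \<Rightarrow> Poly_Mapping.lookup a) \<in> subcontents N k ?c"
      using ab ab' by (auto simp: subcontents_def c)
  next
    fix a assume a: "a \<in> subcontents N k ?c"
    have "i < N" if "a i \<noteq> 0 \<or> ?c i - a i \<noteq> 0" for i
      using that a u[of i] by (cases "i < N") (auto simp: subcontents_def)
    then have "{i. a i \<noteq> 0} \<subseteq> {..<N}" "{i. ?c i - a i \<noteq> 0} \<subseteq> {..<N}" by auto
    then have "finite {i. a i \<noteq> 0}" "finite {i. ?c i - a i \<noteq> 0}"
      using finite_subset finite_lessThan by metis+
    then have l: "Poly_Mapping.lookup (Abs_poly_mapping a) = a"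
      "Poly_Mapping.lookup (Abs_poly_mapping (\<lambda>i. ?c i - a i)) = (\<lambda>i. ?c i - a i)"
      by (simp_all add: Abs_poly_mapping_inverse)
    then show "(case (Abs_poly_mapping a, Abs_poly_mapping (\<lambda>i. ?c i - a i)) of (a, b) \<Rightarrow> Poly_Mapping.lookup a) = a"
      by simp
    show "(Abs_poly_mapping a, Abs_poly_mapping (\<lambda>i. ?c i - a i)) \<in>
        {(a, b) \<in> splits u. (\<Sum>i<N. Poly_Mapping.lookup a i) = k}"
      using a l by (auto simp: splits_def subcontents_def lookup_add intro!: poly_mapping_eqI)
  qed
  also have "\<dots> = (\<Sum>f | hstrip k g f. int (kostka N f ?c))"
    using pieri_kostka[OF g, where k = k and N = N and c = ?c] by (simp flip: of_nat_sum)
  also have "\<dots> = mcoeff (\<Sum>f | hstrip k g f. schurf f) u"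
    unfolding mcoeff_sum
    by (rule sum.cong) (auto simp: mcoeff_schurf[where N = N] hstrip_young u)
  finally show "mcoeff (schurf (row_shape k) * schurf g) u = mcoeff (\<Sum>f | hstrip k g f. schurf f) u" .
qed

section \<open>Multiplication by a sum of products of two one-row functions\<close>

definition two_strip_sum :: "'a \<Rightarrow> (nat \<Rightarrow> nat) \<Rightarrow> (nat \<Rightarrow> nat) \<Rightarrow> 'a :: comm_ring_1" where
  "two_strip_sum \<epsilon> g f = (\<Sum>h | interlace g h \<and> interlace h f. \<epsilon> ^ (ysize h - ysize g))"

definition youngs :: "nat \<Rightarrow> (nat \<Rightarrow> nat) set" where
  "youngs n = {f. young f \<and> ysize f = n}"

lemma finite_youngs: "finite (youngs n)"
  unfolding youngs_def by (rule finite_subset[OF _ finite_young_size[of n]]) auto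

lemma row_times_schurf_sum:
  "schurf (row_shape k) * (\<Sum>g\<in>youngs n. c g * schurf g) =
    (\<Sum>f\<in>youngs (n + k). (\<Sum>g | hstrip k g f \<and> ysize g = n. c g) * schurf f)"
proof -
  have "schurf (row_shape k) * (\<Sum>g\<in>youngs n. c g * schurf g) =
      (\<Sum>g\<in>youngs n. \<Sum>f | f \<in> youngs (n + k) \<and> hstrip k g f. c g * schurf f)"
    unfolding sum_distrib_left
  proof (rule sum.cong[OF refl])
    fix g assume g: "g \<in> youngs n"
    then have "{f. hstrip k g f} = {f. f \<in> youngs (n + k) \<and> hstrip k g f}"
      by (auto simp: youngs_def dest: hstrip_young hstrip_size)
    then show "schurf (row_shape k) * (c g * schurf g) =
        (\<Sum>f | f \<in> youngs (n + k) \<and> hstrip k g f. c g * schurf f)"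
      using pieri[of g k] g by (simp add: youngs_def mult.left_commute sum_distrib_left)
  qed
  also have "\<dots> = (\<Sum>f\<in>youngs (n + k). \<Sum>g | g \<in> youngs n \<and> hstrip k g f. c g * schurf f)"
    by (rule sum.swap_restrict) (simp_all add: finite_youngs)
  also have "\<dots> = (\<Sum>f\<in>youngs (n + k). (\<Sum>g | hstrip k g f \<and> ysize g = n. c g) * schurf f)"
    unfolding sum_distrib_right
    by (intro sum.cong) (auto simp: youngs_def dest: hstrip_young)
  finally show ?thesis .
qed

text \<open>Apply Pieri twice, from \<open>g\<close> to \<open>h\<close> and from \<open>h\<close>
  to \<open>f\<close>. Since \<open>ysize g = n\<close>, the index \<open>i\<close> can be read off
  from \<open>h\<close>, so summing over \<open>i\<close> merely lifts the restriction on the size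
  of \<open>h\<close>. A general \<epsilon> covers both parts of the theorem.\<close>

lemma two_rows_times_schurf_sum:
  fixes c :: "(nat \<Rightarrow> nat) \<Rightarrow> mfps"
  shows "(\<Sum>g\<in>youngs n. c g * schurf g) *
      (\<Sum>i=0..m. \<epsilon> ^ i * schurf (row_shape i) * schurf (row_shape (m - i))) =
    (\<Sum>f\<in>youngs (n + m). (\<Sum>g\<in>youngs n. two_strip_sum \<epsilon> g f * c g) * schurf f)"
proof -
  let ?S = "\<lambda>f i. \<Sum>h | hstrip (m - i) h f \<and> ysize h = n + i. \<Sum>g | hstrip i g h \<and> ysize g = n. c g"
  have "(\<Sum>g\<in>youngs n. c g * schurf g) *
      (\<Sum>i=0..m. \<epsilon> ^ i * schurf (row_shape i) * schurf (row_shape (m - i))) =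
      (\<Sum>i=0..m. \<epsilon> ^ i * (schurf (row_shape (m - i)) * (schurf (row_shape i) *
        (\<Sum>g\<in>youngs n. c g * schurf g))))"
    by (simp add: sum_distrib_left mult_ac)
  also have "\<dots> = (\<Sum>i=0..m. \<Sum>f\<in>youngs (n + m). \<epsilon> ^ i * (?S f i * schurf f))"
  proof (rule sum.cong[OF refl])
    fix i assume "i \<in> {0..m}"
    then have "n + i + (m - i) = n + m" by simp
    then show "\<epsilon> ^ i * (schurf (row_shape (m - i)) * (schurf (row_shape i) *
        (\<Sum>g\<in>youngs n. c g * schurf g))) = (\<Sum>f\<in>youngs (n + m). \<epsilon> ^ i * (?S f i * schurf f))"
      by (simp only: row_times_schurf_sum sum_distrib_left[symmetric])
  qed
  also have "\<dots> = (\<Sum>f\<in>youngs (n + m). (\<Sum>i=0..m. \<epsilon> ^ i * ?S f i) * schurf f)"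
    by (subst sum.swap) (simp add: sum_distrib_right mult.assoc)
  also have "\<dots> = (\<Sum>f\<in>youngs (n + m). (\<Sum>g\<in>youngs n. two_strip_sum \<epsilon> g f * c g) * schurf f)"
  proof (rule sum.cong[OF refl])
    fix f assume "f \<in> youngs (n + m)"
    then have f: "young f" "ysize f = n + m" by (auto simp: youngs_def)
    let ?A = "SIGMA i:{0..m}. SIGMA h:{h. hstrip (m - i) h f \<and> ysize h = n + i}. {g. hstrip i g h \<and> ysize g = n}"
    let ?B = "SIGMA g:youngs n. {h. interlace g h \<and> interlace h f}"
    have fin1: "finite {h. hstrip k h f' \<and> ysize h = j}" for k f' j
      by (rule finite_subset[OF _ finite_hstrip_below[of k f']]) auto
    have fin2: "finite {h. interlace g h \<and> interlace h f}" for g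
      by (rule finite_subset[OF _ finite_interlace_below[OF f(1)]]) auto
    have "(\<Sum>i=0..m. \<epsilon> ^ i * ?S f i) = (\<Sum>(i, h, g)\<in>?A. \<epsilon> ^ i * c g)"
      by (simp add: sum_distrib_left sum.Sigma fin1 case_prod_beta)
    also have "\<dots> = (\<Sum>(g, h)\<in>?B. \<epsilon> ^ (ysize h - ysize g) * c g)"
    proof (rule sum.reindex_bij_witness[where i = "\<lambda>(g, h). (ysize h - ysize g, h, g)"
          and j = "\<lambda>(i, h, g). (g, h)"])
      fix gh assume "gh \<in> ?B"
      then obtain g h where gh: "gh = (g, h)" "interlace g h" "interlace h f" "young g" "ysize g = n"
        by (auto simp: youngs_def)
      then have "young h" using interlace_young by blast
      then show "(case gh of (g, h) \<Rightarrow> (ysize h - ysize g, h, g)) \<in> ?A"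
        using interlace_ysize_le[of g h] interlace_ysize_le[of h f] f gh by (auto simp: hstrip_def)
    next
      fix t assume "t \<in> ?A"
      then obtain i h g where t: "t = (i, h, g)" "hstrip (m - i) h f" "hstrip i g h" "ysize g = n"
        "ysize h = n + i" by auto
      then show "(case t of (i, h, g) \<Rightarrow> (g, h)) \<in> ?B"
        by (auto simp: hstrip_def youngs_def)
      show "(case case t of (i, h, g) \<Rightarrow> (g, h) of (g, h) \<Rightarrow> (ysize h - ysize g, h, g)) = t"
        using t by simp
      show "(case case t of (i, h, g) \<Rightarrow> (g, h) of (g, h) \<Rightarrow> \<epsilon> ^ (ysize h - ysize g) * c g) =
          (case t of (i, h, g) \<Rightarrow> \<epsilon> ^ i * c g)"
        using t by simp
    qed auto
    also have "\<dots> = (\<Sum>g\<in>youngs n. two_strip_sum \<epsilon> g f * c g)"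
      by (subst sum.Sigma[symmetric])
        (auto simp: finite_youngs fin2 two_strip_sum_def sum_distrib_right)
    finally show "(\<Sum>i=0..m. \<epsilon> ^ i * ?S f i) * schurf f =
        (\<Sum>g\<in>youngs n. two_strip_sum \<epsilon> g f * c g) * schurf f"
      by simp
  qed
  finally show ?thesis .
qed

section \<open>Symplectic tableaux\<close>

text \<open>Formulated for a content function instead of a tableau, so that it can be the predicate
  in \<open>card_tableaux_Suc\<close>.\<close>

definition symplectic_weight :: "nat \<Rightarrow> (nat \<Rightarrow> nat) \<Rightarrow> (nat \<Rightarrow> nat) \<Rightarrow> bool" where
  "symplectic_weight l m t \<longleftrightarrow> t 0 = m 0 \<and> (\<forall>i\<in>{1..l}. t (2 * i - 1) + t (2 * i) = m i)"

definition symplectic_count :: "nat \<Rightarrow> (nat \<Rightarrow> nat) \<Rightarrow> (nat \<Rightarrow> nat) \<Rightarrow> nat" where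
  "symplectic_count l m f =
    card {T \<in> tableaux (2 * l + 1) f. symplectic_weight l m (content (boxes f) T)}"

lemma card_symplectic_tableaux:
  assumes f: "young (part \<mu>)"
  shows "card (symplectic_tableaux l m \<mu>) = symplectic_count l m (part \<mu>)"
proof -
  let ?f = "part \<mu>"
  have fin: "finite (boxes ?f)" by (rule card_boxes(1)[OF f])
  \<comment> \<open>The two symbols differ only from \<open>i = 1\<close> on: at
    \<open>i = 0\<close> truncated subtraction would make both of them 0.\<close>
  have pair: "card {b \<in> boxes ?f. T b \<in> {2 * i - 1, 2 * i}} =
      content (boxes ?f) T (2 * i - 1) + content (boxes ?f) T (2 * i)" if "1 \<le> i" for i T
  proof -
    have "{b \<in> boxes ?f. T b \<in> {2 * i - 1, 2 * i}} =
        {b \<in> boxes ?f. T b = 2 * i - 1} \<union> {b \<in> boxes ?f. T b = 2 * i}"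
      by auto
    moreover have "{b \<in> boxes ?f. T b = 2 * i - 1} \<inter> {b \<in> boxes ?f. T b = 2 * i} = {}"
      using that by auto
    ultimately show ?thesis
      using fin by (simp add: content_def card_Un_disjoint)
  qed
  \<comment> \<open>An entry 0 below the first row would exceed the entry at the top of its column,
    so all zeros lie in row 0.\<close>
  have first_row: "card {b \<in> boxes ?f. T b = 0} \<le> ?f 0" if "ssyt (boxes ?f) T" for T
  proof -
    have "{b \<in> boxes ?f. T b = 0} \<subseteq> {0} \<times> {..<?f 0}"
    proof
      fix b assume b: "b \<in> {b \<in> boxes ?f. T b = 0}"
      then obtain i j where ij: "b = (i, j)" "j < ?f i" "T (i, j) = 0" by (cases b) auto
      then have "i = 0"
        using ssyt_column[OF that f, of 0 i j] by auto
      then show "b \<in> {0} \<times> {..<?f 0}" using ij by simp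
    qed
    from card_mono[OF _ this] show ?thesis by simp
  qed
  have "{0..2 * l} = {..<2 * l + 1}" by auto
  moreover have "(\<forall>i\<in>{1..l}. card {b \<in> boxes ?f. T b \<in> {2 * i - 1, 2 * i}} = m i) \<longleftrightarrow>
      (\<forall>i\<in>{1..l}. content (boxes ?f) T (2 * i - 1) + content (boxes ?f) T (2 * i) = m i)" for T
    by (rule ball_cong[OF refl]) (simp only: pair atLeastAtMost_iff)
  moreover have "m 0 \<le> ?f 0 \<and> ssyt (boxes ?f) T \<and> content (boxes ?f) T 0 = m 0 \<and> P \<longleftrightarrow>
      ssyt (boxes ?f) T \<and> content (boxes ?f) T 0 = m 0 \<and> P" for T P
    using first_row[of T] by (auto simp: content_def)
  ultimately have "symplectic_tableaux l m \<mu> =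
      {T \<in> tableaux (2 * l + 1) ?f. symplectic_weight l m (content (boxes ?f) T)}"
    unfolding symplectic_tableaux_def tableaux_def symplectic_weight_def semistandard_ssyt
      diagram_boxes content_def[of _ _ 0, symmetric] by auto
  then show ?thesis by (simp add: symplectic_count_def)
qed

lemma interlace_zero: "interlace (\<lambda>_. 0) f \<longleftrightarrow> f = row_shape (f 0)"
proof
  assume "interlace (\<lambda>_. 0) f"
  then have "f i = row_shape (f 0) i" for i
    by (cases i) (auto simp: interlace_def row_shape_def)
  then show "f = row_shape (f 0)" by blast
next
  assume "f = row_shape (f 0)"
  then have "f (Suc i) = row_shape (f 0) (Suc i)" for i
    by (rule fun_cong)
  then show "interlace (\<lambda>_. 0) f"
    by (simp add: interlace_def row_shape_def)
qed

lemma young_size_zero: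
  assumes "young f" "ysize f = 0"
  shows "f = (\<lambda>_. 0)"
  using young_le_ysize[OF assms(1)] assms(2) by (simp add: fun_eq_iff)

lemma kostka_one:
  assumes f: "young f"
  shows "kostka 1 f c = (if f = row_shape (c 0) then 1 else 0)"
proof (cases "f = row_shape (c 0)")
  case True
  then show ?thesis by (simp add: kostka_row_shape)
next
  case False
  have "kostka 0 g c = 0" if "interlace g f" "ysize f = ysize g + c 0" for g
  proof -
    have g: "young g" using that f interlace_young by blast
    have "ysize g \<noteq> 0"
    proof
      assume "ysize g = 0"
      then have "f = row_shape (f 0)"
        using that young_size_zero[OF g] interlace_zero by simp
      moreover from this have "ysize f = f 0"
        by (metis ysize_row_shape)
      ultimately show False
        using False that \<open>ysize g = 0\<close> by simp
    qed
    then show ?thesis by (simp add: kostka_0 g)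
  qed
  then show ?thesis
    using False kostka_Suc[OF f, of 0 c] by simp
qed

lemma symplectic_count_0:
  assumes "young f"
  shows "symplectic_count 0 m f = (if f = row_shape (m 0) then 1 else 0)"
  using kostka_one[OF assms, of m]
  by (simp add: symplectic_count_def symplectic_weight_def kostka_def)

text \<open>The pair of symbols for \<open>Suc l\<close> is removed in two steps: the unbarred one,
  \<open>2 * l + 2\<close>, leads from \<open>f\<close> to \<open>h\<close>, the barred one,
  \<open>2 * l + 1\<close>, from \<open>h\<close> to \<open>g\<close>. Only their total number is
  prescribed, so \<open>h\<close> is any shape between \<open>g\<close> and
  \<open>f\<close>.\<close>

lemma symplectic_count_Suc:
  assumes "f \<in> youngs (n + m (Suc l))"
  shows "of_nat (symplectic_count (Suc l) m f) =
    (\<Sum>g\<in>youngs n. two_strip_sum (1 :: 'a :: comm_ring_1) g f * of_nat (symplectic_count l m g))"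
proof -
  have f: "young f" "ysize f = n + m (Suc l)" using assms by (auto simp: youngs_def)
  have fin: "finite {h. interlace h f}" by (rule finite_interlace_below[OF f(1)])
  let ?q = "symplectic_weight (Suc l) m"
  have "symplectic_count (Suc l) m f = (\<Sum>h | interlace h f. card {T \<in> tableaux (Suc (2 * l + 1)) h.
      ?q ((content (boxes h) T)(2 * l + 2 := ysize f - ysize h))})"
    using card_tableaux_Suc[OF f(1), where N = "Suc (2 * l + 1)" and Q = ?q]
    by (simp add: symplectic_count_def)
  also have "\<dots> = (\<Sum>h | interlace h f. \<Sum>g | interlace g h. card {T \<in> tableaux (2 * l + 1) g.
      ?q ((content (boxes g) T)(2 * l + 1 := ysize h - ysize g, 2 * l + 2 := ysize f - ysize h))})"
  proof (rule sum.cong[OF refl])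
    fix h assume "h \<in> {h. interlace h f}"
    then have "young h" using f interlace_young by blast
    then show "card {T \<in> tableaux (Suc (2 * l + 1)) h.
        ?q ((content (boxes h) T)(2 * l + 2 := ysize f - ysize h))} =
      (\<Sum>g | interlace g h. card {T \<in> tableaux (2 * l + 1) g.
      ?q ((content (boxes g) T)(2 * l + 1 := ysize h - ysize g, 2 * l + 2 := ysize f - ysize h))})"
      by (rule card_tableaux_Suc[where N = "2 * l + 1" and Q = "\<lambda>t. ?q (t(2 * l + 2 := ysize f - ysize h))"])
  qed
  also have "\<dots> = (\<Sum>h | interlace h f. \<Sum>g | g \<in> youngs n \<and> interlace g h. symplectic_count l m g)"
  proof (rule sum.cong[OF refl])
    fix h assume "h \<in> {h. interlace h f}"
    then have h: "interlace h f" "young h" "ysize h \<le> ysize f"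
      using f interlace_young interlace_ysize_le by blast+
    have "card {T \<in> tableaux (2 * l + 1) g.
        ?q ((content (boxes g) T)(2 * l + 1 := ysize h - ysize g, 2 * l + 2 := ysize f - ysize h))} =
        (if g \<in> youngs n then symplectic_count l m g else 0)" if "interlace g h" for g
    proof -
      have g: "young g" "ysize g \<le> ysize h"
        using that h interlace_young interlace_ysize_le by blast+
      \<comment> \<open>The updates change only the two symbols for \<open>Suc l\<close>, and (|h| -
        |g|) + (|f| - |h|) = |f| - |g|, so the size of \<open>h\<close> drops out.\<close>
      have "?q (t(2 * l + 1 := ysize h - ysize g, 2 * l + 2 := ysize f - ysize h)) \<longleftrightarrow>
          symplectic_weight l m t \<and> ysize g = n" for t
      proof -
        let ?t = "t(2 * l + 1 := ysize h - ysize g, 2 * l + 2 := ysize f - ysize h)"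
        have "{1..Suc l} = insert (Suc l) {1..l}" by auto
        moreover have "?t (2 * i - 1) = t (2 * i - 1)" "?t (2 * i) = t (2 * i)" if "i \<in> {1..l}" for i
          using that by auto
        moreover have "?t 0 = t 0" by simp
        moreover have "?t (2 * Suc l - 1) + ?t (2 * Suc l) = m (Suc l) \<longleftrightarrow> ysize g = n"
          using g h f by auto
        ultimately show ?thesis
          unfolding symplectic_weight_def by (simp only: ball_simps cong: ball_cong) blast
      qed
      then show ?thesis using g by (simp add: symplectic_count_def youngs_def)
    qed
    then have "(\<Sum>g | interlace g h. card {T \<in> tableaux (2 * l + 1) g.
        ?q ((content (boxes g) T)(2 * l + 1 := ysize h - ysize g, 2 * l + 2 := ysize f - ysize h))}) =
        (\<Sum>g | interlace g h. if g \<in> youngs n then symplectic_count l m g else 0)"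
      by (intro sum.cong) auto
    also have "\<dots> = (\<Sum>g\<in>{g. interlace g h} \<inter> {g. g \<in> youngs n}. symplectic_count l m g)"
      using finite_interlace_below[OF h(2)] by (simp add: sum.inter_restrict)
    also have "{g. interlace g h} \<inter> {g. g \<in> youngs n} = {g. g \<in> youngs n \<and> interlace g h}" by auto
    finally show "(\<Sum>g | interlace g h. card {T \<in> tableaux (2 * l + 1) g.
        ?q ((content (boxes g) T)(2 * l + 1 := ysize h - ysize g, 2 * l + 2 := ysize f - ysize h))}) =
        (\<Sum>g | g \<in> youngs n \<and> interlace g h. symplectic_count l m g)" .
  qed
  also have "\<dots> = (\<Sum>g\<in>youngs n. \<Sum>h | h \<in> {h. interlace h f} \<and> interlace g h. symplectic_count l m g)"
    by (rule sum.swap_restrict[OF fin finite_youngs])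
  also have "\<dots> = (\<Sum>g\<in>youngs n. card {h. interlace g h \<and> interlace h f} * symplectic_count l m g)"
    by (simp add: conj_commute)
  finally show ?thesis
    by (simp add: two_strip_sum_def)
qed

lemma symplectic_identity:
  "schurf (row_shape (m 0)) * (\<Prod>r=1..l. \<Sum>i=0..m r. schurf (row_shape i) * schurf (row_shape (m r - i))) =
    (\<Sum>f\<in>youngs (\<Sum>r=0..l. m r). of_nat (symplectic_count l m f) * schurf f)"
proof (induction l)
  case 0
  have "(\<Sum>f\<in>youngs (m 0). of_nat (symplectic_count 0 m f) * schurf f) =
      (\<Sum>f\<in>youngs (m 0). if f = row_shape (m 0) then schurf f else 0)"
    by (rule sum.cong) (auto simp: symplectic_count_0 youngs_def)
  also have "\<dots> = schurf (row_shape (m 0))"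
    by (simp add: finite_youngs) (simp add: youngs_def young_row_shape)
  finally show ?case by simp
next
  case (Suc l)
  let ?n = "\<Sum>r=0..l. m r"
  have "schurf (row_shape (m 0)) * (\<Prod>r=1..Suc l. \<Sum>i=0..m r. schurf (row_shape i) * schurf (row_shape (m r - i))) =
      (\<Sum>f\<in>youngs ?n. of_nat (symplectic_count l m f) * schurf f) *
      (\<Sum>i=0..m (Suc l). 1 ^ i * schurf (row_shape i) * schurf (row_shape (m (Suc l) - i)))"
    by (simp add: Suc.IH[symmetric] mult.assoc)
  also have "\<dots> = (\<Sum>f\<in>youngs (?n + m (Suc l)). of_nat (symplectic_count (Suc l) m f) * schurf f)"
    unfolding two_rows_times_schurf_sum
    by (rule sum.cong[OF refl]) (simp add: symplectic_count_Suc)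
  finally show ?case by simp
qed

section \<open>Domino strips\<close>

text \<open>
  The boxes of row \<open>i\<close> of \<open>f / g\<close> that are alone in their column are those in the columns
  \<open>run_start g f i, \<dots>, run_end g f i - 1\<close>.
\<close>

definition run_start :: "(nat \<Rightarrow> nat) \<Rightarrow> (nat \<Rightarrow> nat) \<Rightarrow> nat \<Rightarrow> nat" where
  "run_start g f i = max (g i) (f (Suc i))"

definition run_end :: "(nat \<Rightarrow> nat) \<Rightarrow> (nat \<Rightarrow> nat) \<Rightarrow> nat \<Rightarrow> nat" where
  "run_end g f i = (case i of 0 \<Rightarrow> f 0 | Suc j \<Rightarrow> min (f (Suc j)) (g j))"

text \<open>The inequality contains \<open>g i \<le> f i\<close> and
  \<open>f (Suc (Suc i)) \<le> g i\<close>, so no column has three boxes of \<open>f / g\<close>;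
  evenness is what cutting every run into horizontal dominoes requires.\<close>

definition domino_strip :: "(nat \<Rightarrow> nat) \<Rightarrow> (nat \<Rightarrow> nat) \<Rightarrow> bool" where
  "domino_strip g f \<longleftrightarrow> (\<forall>i. run_start g f i \<le> run_end g f i \<and> even (run_end g f i - run_start g f i))"

definition nstat :: "(nat \<Rightarrow> nat) \<Rightarrow> nat" where
  "nstat f = (\<Sum>i | f i \<noteq> 0. i * f i)"

lemma nstat_eq: "(\<And>i. L \<le> i \<Longrightarrow> f i = 0) \<Longrightarrow> nstat f = (\<Sum>i<L. i * f i)"
  unfolding nstat_def
  by (rule sum.mono_neutral_left) (auto intro: ccontr simp: not_less)

lemma n_stat_nstat: "n_stat \<mu> = nstat (part \<mu>)"
  by (subst nstat_eq[of "length \<mu>"]) (auto simp: n_stat_def part_def)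

lemma interlace_between:
  "interlace g h \<and> interlace h f \<longleftrightarrow> (\<forall>i. run_start g f i \<le> h i \<and> h i \<le> run_end g f i)"
proof -
  have "(\<forall>i. h i \<le> run_end g f i) \<longleftrightarrow> (\<forall>i. h i \<le> f i) \<and> (\<forall>i. h (Suc i) \<le> g i)"
    using all_nat_iff[of "\<lambda>i. h i \<le> run_end g f i"] all_nat_iff[of "\<lambda>i. h i \<le> f i"] by (auto simp: run_end_def)
  then show ?thesis
    unfolding interlace_def run_start_def by auto
qed

lemma alternating_sum_interval:
  "(\<Sum>v=a..b. (-1 :: 'a :: comm_ring_1) ^ v) = (if a \<le> b \<and> even (b - a) then (-1) ^ a else 0)"
proof (cases "a \<le> b")
  case True
  then show ?thesis
  proof (induction b rule: dec_induct)
    case (step b)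
    then show ?case
      by (auto simp: Suc_diff_le minus_one_power_iff)
  qed auto
qed auto

text \<open>The exponent |h| - |g| has the parity of |h| + |g|, and (-1)^|h| is a product over rows.
  An alternating sum over an interval with an odd number of elements is the sign of its lower end,
  hence the \<open>run_start\<close> in the exponent.\<close>

lemma two_strip_sum_minus_one_bounded:
  assumes g: "\<And>i. L \<le> Suc i \<Longrightarrow> g i = 0" and f: "\<And>i. L \<le> i \<Longrightarrow> f i = 0"
    and yf: "young f"
  shows "two_strip_sum (-1 :: 'a :: comm_ring_1) g f =
    (if domino_strip g f then (-1) ^ (\<Sum>i<L. run_start g f i + g i) else 0)"
proof -
  have size_g: "ysize g = (\<Sum>i<L. g i)"
    by (rule ysize_eq) (simp add: g)
  \<comment> \<open>From row \<open>L\<close> on both ends of the interval are 0, so only the rows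
    below \<open>L\<close> leave a choice for \<open>h\<close> and the product is finite.\<close>
  have hi0: "run_end g f i = 0" if "L \<le> i" for i
    using that f[of i] by (cases i) (auto simp: run_end_def)
  have lo0: "run_start g f i = 0" if "L \<le> i" for i
    using that f[of "Suc i"] g[of i] by (auto simp: run_start_def)
  let ?H = "{h. interlace g h \<and> interlace h f}"
  let ?P = "Pi\<^sub>E {..<L} (\<lambda>i. {run_start g f i..run_end g f i})"
  have "two_strip_sum (-1 :: 'a) g f = (\<Sum>h\<in>?H. (-1) ^ (\<Sum>i<L. g i) * (-1) ^ (\<Sum>i<L. h i))"
    unfolding two_strip_sum_def
  proof (rule sum.cong[OF refl])
    fix h assume h: "h \<in> ?H"
    then have yh: "young h" and le: "ysize g \<le> ysize h"
      using yf interlace_young[of h f] interlace_ysize_le[of g h] by auto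
    have "h i = 0" if "L \<le> i" for i
    proof -
      have "h i \<le> run_end g f i"
        using h interlace_between[of g h f] by blast
      then show ?thesis using hi0[OF that] by simp
    qed
    then have "ysize h = (\<Sum>i<L. h i)"
      by (rule ysize_eq)
    moreover have "even (ysize h - ysize g) \<longleftrightarrow> even (ysize g + ysize h)"
      using le even_diff_nat[of "ysize h" "ysize g"] by (simp add: add.commute)
    ultimately show "(-1) ^ (ysize h - ysize g) = (-1 :: 'a) ^ (\<Sum>i<L. g i) * (-1) ^ (\<Sum>i<L. h i)"
      by (simp add: size_g flip: power_add) (simp add: minus_one_power_iff)
  qed
  also have "\<dots> = (-1) ^ (\<Sum>i<L. g i) * (\<Sum>h\<in>?H. \<Prod>i<L. (-1) ^ h i)"
    by (simp add: sum_distrib_left power_sum)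
  also have "(\<Sum>h\<in>?H. \<Prod>i<L. (-1 :: 'a) ^ h i) = (\<Sum>h\<in>?P. \<Prod>i<L. (-1) ^ h i)"
  proof (rule sum.reindex_bij_witness[where j = "\<lambda>h. restrict h {..<L}"
        and i = "\<lambda>h i. if i < L then h i else 0"])
    fix h assume "h \<in> ?H"
    then have h: "run_start g f i \<le> h i \<and> h i \<le> run_end g f i" for i
      using interlace_between by blast
    show "(\<lambda>i. if i < L then restrict h {..<L} i else 0) = h"
    proof
      fix i
      show "(if i < L then restrict h {..<L} i else 0) = h i"
        using h[of i] hi0[of i] by auto
    qed
    show "restrict h {..<L} \<in> ?P" using h by auto
  next
    fix h assume h: "h \<in> ?P"
    show "restrict (\<lambda>i. if i < L then h i else 0) {..<L} = h"
    proof
      fix i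
      show "restrict (\<lambda>i. if i < L then h i else 0) {..<L} i = h i"
        using PiE_arb[OF h, of i] by (cases "i < L") auto
    qed
    show "(\<lambda>i. if i < L then h i else 0) \<in> ?H"
      unfolding mem_Collect_eq interlace_between
    proof
      fix i
      show "run_start g f i \<le> (if i < L then h i else 0) \<and> (if i < L then h i else 0) \<le> run_end g f i"
        using PiE_mem[OF h, of i] lo0[of i] by (cases "i < L") auto
    qed
  qed auto
  also have "\<dots> = (\<Prod>i<L. \<Sum>v=run_start g f i..run_end g f i. (-1) ^ v)"
    by (rule prod_sum_PiE[symmetric]) auto
  also have "\<dots> = (if domino_strip g f then (-1) ^ (\<Sum>i<L. run_start g f i) else 0)"
  proof (cases "domino_strip g f")
    case True
    then show ?thesis
      by (simp add: domino_strip_def alternating_sum_interval power_sum)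
  next
    case False
    then obtain i where i: "\<not> (run_start g f i \<le> run_end g f i \<and> even (run_end g f i - run_start g f i))"
      by (auto simp: domino_strip_def)
    then have "i < L"
      using hi0[of i] lo0[of i] by (cases "i < L") auto
    moreover have "(\<Sum>v=run_start g f i..run_end g f i. (-1 :: 'a) ^ v) = 0"
      unfolding alternating_sum_interval by (simp only: i if_False)
    ultimately have "(\<Prod>i<L. \<Sum>v=run_start g f i..run_end g f i. (-1 :: 'a) ^ v) = 0"
      by (intro prod_zero bexI[of _ i]) auto
    then show ?thesis using False by simp
  qed
  finally show ?thesis
    by (auto simp: sum.distrib power_add)
qed

text \<open>Put a_i = \<open>run_start g f i + g i\<close>. As max and min of two numbers have their
  sum, \<open>f (Suc i) + g i\<close> equals \<open>run_end g f (Suc i) + run_start g f i\<close>,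
  and \<open>run_end\<close> has the parity of \<open>run_start\<close> in each row; so
  \<open>f (Suc i) + g (Suc i)\<close> is congruent to a_(i+1) + a_i mod 2. In the sum of
  \<open>i * (f i + g i)\<close> the term a_i then gets the coefficient i + (i + 1), which is odd,
  and only the last one, a_k, gets k.\<close>

lemma domino_strip_parity:
  assumes "domino_strip g f"
  shows "even ((\<Sum>i<Suc k. i * (f i + g i)) + (\<Sum>i<k. run_start g f i + g i) + k * (run_start g f k + g k))"
proof (induction k)
  case (Suc k)
  have "run_start g f (Suc k) \<le> run_end g f (Suc k)" "even (run_end g f (Suc k) - run_start g f (Suc k))"
    using assms by (auto simp: domino_strip_def)
  moreover have "f (Suc k) + g k = run_end g f (Suc k) + run_start g f k"
    by (auto simp: run_end_def run_start_def)
  ultimately have "even (f (Suc k) + g k) \<longleftrightarrow> even (run_start g f (Suc k) + run_start g f k)"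
    by simp
  then have "even (f (Suc k) + g (Suc k)) \<longleftrightarrow> even ((run_start g f (Suc k) + g (Suc k)) + (run_start g f k + g k))"
    by (simp add: even_add) blast
  then show ?case
    using Suc.IH by (simp add: even_add) blast
qed simp

lemma two_strip_sum_minus_one:
  assumes f: "young f" and g: "young g"
  shows "two_strip_sum (-1 :: 'a :: comm_ring_1) g f =
    (if domino_strip g f then (-1) ^ (nstat f + nstat g) else 0)"
proof -
  obtain L where L: "\<And>i. L \<le> i \<Longrightarrow> g i = 0" using young_bound[OF g] by blast
  obtain M where M: "\<And>i. M \<le> i \<Longrightarrow> f i = 0" using young_bound[OF f] by blast
  define K where "K = Suc (L + M)"
  have 0: "g i = 0" "f i = 0" if "K \<le> Suc i" for i
    using that L M by (auto simp: K_def)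
  have 1: "f i = 0" if "K \<le> i" for i
    using that 0[of i] by simp
  have "even (\<Sum>i<K. run_start g f i + g i) \<longleftrightarrow> even (nstat f + nstat g)" if "domino_strip g f"
  proof -
    have "nstat f + nstat g = (\<Sum>i<Suc K. i * (f i + g i))"
      using 0 nstat_eq[of "Suc K" f] nstat_eq[of "Suc K" g]
      by (simp add: sum.distrib distrib_left)
    \<comment> \<open>At \<open>K\<close> the boundary term of this summation vanishes.\<close>
    moreover have "run_start g f K + g K = 0"
      using 0 by (simp add: run_start_def)
    ultimately show ?thesis
      using domino_strip_parity[OF that, of K] by (simp add: even_add)
  qed
  moreover have "two_strip_sum (-1 :: 'a) g f =
      (if domino_strip g f then (-1) ^ (\<Sum>i<K. run_start g f i + g i) else 0)"
    by (rule two_strip_sum_minus_one_bounded) (simp_all add: 0 1 f)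
  ultimately show ?thesis
    by (simp add: minus_one_power_iff)
qed

section \<open>Tilings by dominoes that occupy disjoint sets of columns\<close>

definition strip_tiling :: "(nat \<Rightarrow> nat) \<Rightarrow> (nat \<Rightarrow> nat) \<Rightarrow> (nat \<times> nat) set set \<Rightarrow> bool" where
  "strip_tiling g f Q \<longleftrightarrow> partition_on (boxes f - boxes g) Q \<and> (\<forall>d\<in>Q. domino d) \<and>
     (\<forall>d\<in>Q. \<forall>d'\<in>Q. \<forall>i i' j. (i, j) \<in> d \<longrightarrow> (i', j) \<in> d' \<longrightarrow> d = d')"

abbreviation horiz :: "nat \<Rightarrow> nat \<Rightarrow> (nat \<times> nat) set" where
  "horiz i j \<equiv> {(i, j), (i, Suc j)}"

abbreviation vert :: "nat \<Rightarrow> nat \<Rightarrow> (nat \<times> nat) set" where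
  "vert i j \<equiv> {(i, j), (Suc i, j)}"

text \<open>The only candidate for such a tiling: vertical dominoes in the columns with two boxes of
  \<open>f / g\<close>, and each run cut into pairs from its left end.\<close>

definition strip_dominoes :: "(nat \<Rightarrow> nat) \<Rightarrow> (nat \<Rightarrow> nat) \<Rightarrow> (nat \<times> nat) set set" where
  "strip_dominoes g f = {vert i j | i j. g i \<le> j \<and> j < f (Suc i)} \<union>
     {horiz i j | i j. run_start g f i \<le> j \<and> Suc j < run_end g f i \<and> even (j - run_start g f i)}"

lemma horiz_strip_dominoes:
  "run_start g f i \<le> j \<Longrightarrow> Suc j < run_end g f i \<Longrightarrow> even (j - run_start g f i) \<Longrightarrow> horiz i j \<in> strip_dominoes g f"
  unfolding strip_dominoes_def by blast

lemma domino_cases: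
  assumes "domino d"
  obtains i j where "d = horiz i j" | i j where "d = vert i j"
  using assms unfolding domino_def by auto

lemma less_run_end: "j < run_end g f i \<longleftrightarrow> j < f i \<and> (\<forall>k. i = Suc k \<longrightarrow> j < g k)"
  by (cases i) (auto simp: run_end_def)

lemma run_start_le: "run_start g f i \<le> j \<longleftrightarrow> g i \<le> j \<and> f (Suc i) \<le> j"
  by (simp add: run_start_def)

lemma domino_strip_le:
  assumes "domino_strip g f"
  shows "g i \<le> f i" "g (Suc i) \<le> g i" "f (Suc (Suc i)) \<le> g i"
proof -
  have *: "run_start g f i \<le> run_end g f i" for i using assms by (simp add: domino_strip_def)
  show "g i \<le> f i"
    using *[of i] less_run_end[of "f i" g f i] run_start_le[of g f i "run_end g f i"] by (simp add: not_less)
  show "g (Suc i) \<le> g i" "f (Suc (Suc i)) \<le> g i"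
    using *[of "Suc i"] by (auto simp: run_start_def run_end_def)
qed

context
  fixes g f :: "nat \<Rightarrow> nat"
  assumes g: "young g" and f: "young f" and le: "\<And>i. g i \<le> f i"
begin

text \<open>A column has at most one vertical domino (\<open>vv\<close>), no run passes through its
  column (\<open>vh\<close>), and runs of different rows share no column (\<open>hh\<close>). Within
  one run all dominoes start at the same parity, so two that share a column coincide.\<close>

lemma strip_dominoes_column:
  assumes strip: "domino_strip g f" and d: "d \<in> strip_dominoes g f" "d' \<in> strip_dominoes g f"
    and ij: "(i, j) \<in> d" "(i', j) \<in> d'"
  shows "d = d'"
proof -
  have two: "f (Suc b) \<le> g a" if "a < b" for a b
    using domino_strip_le(3)[OF strip, of a] youngD[OF f, of "Suc (Suc a)" "Suc b"] that by simp
  have vv: "a = b" if "g a \<le> j" "j < f (Suc a)" "g b \<le> j" "j < f (Suc b)" for a b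
    using that two[of a b] two[of b a] by (cases a b rule: linorder_cases) auto
  have vh: False if "g a \<le> j" "j < f (Suc a)" "run_start g f b \<le> j" "j < run_end g f b" for a b
  proof (cases "b \<le> a")
    case True
    then have "f (Suc a) \<le> f (Suc b)" using youngD[OF f] by simp
    then show False using that by (auto simp: run_start_le)
  next
    case False
    then have "Suc a \<le> b" by simp
    then obtain k where "b = Suc k" "a \<le> k" using Suc_le_D by blast
    then have "j < g k" "g k \<le> g a" using that youngD[OF g] by (auto simp: less_run_end)
    then show False using that by simp
  qed
  have hh': False if "run_start g f a \<le> j" "j < run_end g f b" "a < b" for a b
  proof -
    have "Suc a \<le> b" using that by simp
    then obtain k where "b = Suc k" "a \<le> k" using Suc_le_D by blast
    then have "j < g k" "g k \<le> g a" using that youngD[OF g] by (auto simp: less_run_end)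
    then show False using that by (simp add: run_start_le)
  qed
  have hh: "a = b" if "run_start g f a \<le> j" "j < run_end g f a" "run_start g f b \<le> j" "j < run_end g f b" for a b
    using hh'[of a b] hh'[of b a] that by (cases a b rule: linorder_cases) auto
  have d_cases: "(\<exists>a. d = vert a j \<and> g a \<le> j \<and> j < f (Suc a)) \<or>
      (\<exists>a k. d = horiz a k \<and> j \<in> {k, Suc k} \<and> run_start g f a \<le> k \<and> Suc k < run_end g f a \<and> even (k - run_start g f a))"
    if "d \<in> strip_dominoes g f" "(i, j) \<in> d" for d i
    using that unfolding strip_dominoes_def by auto
  from d_cases[OF d(1) ij(1)] d_cases[OF d(2) ij(2)] show ?thesis
  proof (elim disjE exE conjE)
    fix a b assume "d = vert a j" "g a \<le> j" "j < f (Suc a)" "d' = vert b j" "g b \<le> j" "j < f (Suc b)"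
    then show ?thesis using vv by blast
  next
    fix a b k assume "g a \<le> j" "j < f (Suc a)" "j \<in> {k, Suc k}" "run_start g f b \<le> k" "Suc k < run_end g f b"
    then show ?thesis using vh[of a b] by auto
  next
    fix a b k assume "g a \<le> j" "j < f (Suc a)" "j \<in> {k, Suc k}" "run_start g f b \<le> k" "Suc k < run_end g f b"
    then show ?thesis using vh[of a b] by auto
  next
    fix a b k k'
    assume *: "d = horiz a k" "j \<in> {k, Suc k}" "run_start g f a \<le> k" "Suc k < run_end g f a" "even (k - run_start g f a)"
      "d' = horiz b k'" "j \<in> {k', Suc k'}" "run_start g f b \<le> k'" "Suc k' < run_end g f b" "even (k' - run_start g f b)"
    then have "a = b" by (intro hh) auto
    moreover have "even k \<longleftrightarrow> even k'"
      using * \<open>a = b\<close> by simp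
    then have "k = k'" using * by auto
    ultimately show ?thesis using * by simp
  qed
qed

lemma strip_tiling_strip_dominoes:
  assumes strip: "domino_strip g f"
  shows "strip_tiling g f (strip_dominoes g f)"
proof -
  note col = strip_dominoes_column[OF strip]
  have sub: "d \<subseteq> boxes f - boxes g" if "d \<in> strip_dominoes g f" for d
  proof -
    have "j < f (Suc i) \<Longrightarrow> j < f i" "g i \<le> j \<Longrightarrow> \<not> j < g (Suc i)" for i j
      using youngD[OF g, of i "Suc i"] youngD[OF f, of i "Suc i"] by auto
    then show ?thesis
      using that unfolding strip_dominoes_def by (auto simp: less_run_end run_start_le)
  qed
  have cover: "\<exists>d\<in>strip_dominoes g f. (i, j) \<in> d" if ij: "g i \<le> j" "j < f i" for i j
  proof -
    \<comment> \<open>Either the box below or the box above also belongs to \<open>f / g\<close>, or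
      the box is alone in its column and lies in the run of its row.\<close>
    consider "j < f (Suc i)" | k where "i = Suc k" "g k \<le> j" | "run_start g f i \<le> j" "j < run_end g f i"
      using ij unfolding less_run_end run_start_le by (meson not_less)
    then show ?thesis
    proof cases
      case 1
      then have "vert i j \<in> strip_dominoes g f"
        using ij unfolding strip_dominoes_def by blast
      then show ?thesis by blast
    next
      case 2
      then have "vert k j \<in> strip_dominoes g f"
        using ij unfolding strip_dominoes_def by blast
      then show ?thesis using 2 by blast
    next
      case 3
      have ev: "even (run_end g f i - run_start g f i)" using strip by (simp add: domino_strip_def)
      show ?thesis
      proof (cases "even (j - run_start g f i)")
        case True
        \<comment> \<open>A box at even distance from the left end is not the last one of a run of
          even length, so it has a right neighbour to pair with.\<close>
        have "Suc j \<noteq> run_end g f i"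
        proof
          assume "Suc j = run_end g f i"
          then have "run_end g f i - run_start g f i = Suc (j - run_start g f i)" using 3 by simp
          then show False using ev True by (metis even_Suc)
        qed
        then have "horiz i j \<in> strip_dominoes g f"
          using 3 True by (intro horiz_strip_dominoes) auto
        then show ?thesis by blast
      next
        case False
        then obtain k where k: "j = Suc k" "run_start g f i \<le> k" using 3 by (cases j) (auto simp: le_Suc_eq)
        then have "horiz i k \<in> strip_dominoes g f"
          using 3 False by (intro horiz_strip_dominoes) (auto simp: Suc_diff_le)
        then show ?thesis using k by blast
      qed
    qed
  qed
  have "partition_on (boxes f - boxes g) (strip_dominoes g f)"
  proof (rule partition_onI)
    show "\<Union> (strip_dominoes g f) = boxes f - boxes g"
      using sub cover by (fastforce simp: not_less)
    show "disjnt d d'" if "d \<in> strip_dominoes g f" "d' \<in> strip_dominoes g f" "d \<noteq> d'" for d d'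
      using col[OF that(1,2)] that(3) by (fastforce simp: disjnt_def)
    show "{} \<notin> strip_dominoes g f"
      unfolding strip_dominoes_def by auto
  qed
  moreover have "\<forall>d\<in>strip_dominoes g f. domino d"
    unfolding strip_dominoes_def domino_def by fastforce
  ultimately show ?thesis
    unfolding strip_tiling_def using col by blast
qed

text \<open>Boxes in one column must share a domino, so three of them cannot occur and two form a
  vertical domino. A horizontal domino therefore consists of boxes alone in their columns, and such
  a box cannot be in a vertical one. So each run is tiled by horizontal dominoes, which are forced
  from the left end on.\<close>

lemma strip_tiling_unique:
  assumes Q: "strip_tiling g f Q"
  shows "domino_strip g f \<and> Q = strip_dominoes g f"
proof -
  have col: "d = d'" if "d \<in> Q" "d' \<in> Q" "(i, j) \<in> d" "(i', j) \<in> d'" for d d' i i' j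
    using Q that unfolding strip_tiling_def by blast
  have U: "\<Union> Q = boxes f - boxes g"
    using Q partition_onD1 unfolding strip_tiling_def by metis
  have cover: "\<exists>d\<in>Q. (i, j) \<in> d" if "g i \<le> j" "j < f i" for i j
  proof -
    have "(i, j) \<in> \<Union> Q" using that unfolding U by simp
    then show ?thesis by blast
  qed
  have sub: "g i \<le> j \<and> j < f i" if "d \<in> Q" "(i, j) \<in> d" for d i j
  proof -
    have "(i, j) \<in> boxes f - boxes g" using that unfolding U[symmetric] by blast
    then show ?thesis by simp
  qed
  have dom: "domino d" if "d \<in> Q" for d
    using Q that unfolding strip_tiling_def by blast
  have g_dec: "g (Suc i) \<le> g i" and f_dec: "f (Suc i) \<le> f i" for i
    using youngD[OF g] youngD[OF f] by auto
  have two: "f (Suc (Suc i)) \<le> g i" for i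
  proof (rule ccontr)
    let ?j = "g i"
    assume "\<not> ?thesis"
    then have *: "?j < f (Suc (Suc i))" by simp
    obtain d where d: "d \<in> Q" "(i, ?j) \<in> d"
      using cover[of i ?j] * f_dec[of i] f_dec[of "Suc i"] by auto
    obtain d' where d': "d' \<in> Q" "(Suc i, ?j) \<in> d'"
      using cover[of "Suc i" ?j] * f_dec[of "Suc i"] g_dec[of i] by auto
    obtain d'' where d'': "d'' \<in> Q" "(Suc (Suc i), ?j) \<in> d''"
      using cover[of "Suc (Suc i)" ?j] * g_dec[of i] g_dec[of "Suc i"] by auto
    have "(Suc i, ?j) \<in> d" "(Suc (Suc i), ?j) \<in> d"
      using col d d' d'' by blast+
    then show False
      using dom[OF d(1)] d(2) unfolding domino_def by auto
  qed
  have horiz_in: "run_start g f i \<le> j \<and> Suc j < run_end g f i" if d: "horiz i j \<in> Q" for i j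
  proof -
    have b: "g i \<le> j" "Suc j < f i" using sub[OF d, of i j] sub[OF d, of i "Suc j"] by auto
    have "f (Suc i) \<le> j"
    proof (rule ccontr)
      assume "\<not> ?thesis"
      then obtain d' where d': "d' \<in> Q" "(Suc i, j) \<in> d'"
        using cover[of "Suc i" j] b g_dec[of i] by auto
      then have "d' = horiz i j" using col[OF d'(1) d d'(2), of i] by simp
      then show False using d' by simp
    qed
    moreover have "Suc j < g k" if ik: "i = Suc k" for k
    proof (rule ccontr)
      assume "\<not> ?thesis"
      then obtain d' where d': "d' \<in> Q" "(k, Suc j) \<in> d'"
        using cover[of k "Suc j"] b f_dec[of k] ik by auto
      then have "d' = horiz i j" using col[OF d'(1) d d'(2), of i] by simp
      then show False using d' ik by simp
    qed
    ultimately show ?thesis using b by (simp add: run_start_le less_run_end)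
  qed
  have alone: "horiz i j \<in> Q \<or> (\<exists>k. j = Suc k \<and> horiz i k \<in> Q)"
    if ij: "run_start g f i \<le> j" "j < run_end g f i" for i j
  proof -
    obtain d where d: "d \<in> Q" "(i, j) \<in> d"
      using cover[of i j] ij by (auto simp: run_start_le less_run_end)
    from dom[OF d(1)] show ?thesis
    proof (cases rule: domino_cases)
      case (1 a b)
      then show ?thesis using d by auto
    next
      case (2 a b)
      then have "b = j" "i = a \<or> i = Suc a" using d by auto
      moreover have "g a \<le> j" "j < f (Suc a)"
        using sub[OF d(1), of a j] sub[OF d(1), of "Suc a" j] 2 \<open>b = j\<close> by auto
      ultimately show ?thesis using ij by (auto simp: run_start_le less_run_end)
    qed
  qed
  \<comment> \<open>By strong induction: the box left of the domino, if it is in the run, is the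
    right half of another domino, which starts two columns earlier.\<close>
  have parity: "even (j - run_start g f i)" if "horiz i j \<in> Q" for i j
    using that
  proof (induction j rule: less_induct)
    case (less j)
    have b: "run_start g f i \<le> j" "Suc j < run_end g f i" using horiz_in[OF less.prems] by auto
    show ?case
    proof (cases "j = run_start g f i")
      case False
      then obtain k where k: "j = Suc k" "run_start g f i \<le> k" "k < run_end g f i"
        using b by (cases j) auto
      have "horiz i k \<notin> Q"
      proof
        assume "horiz i k \<in> Q"
        then have "horiz i k = horiz i j"
          using col[OF _ less.prems, of "horiz i k" i j i] k by simp
        then show False using k by (auto simp: doubleton_eq_iff)
      qed
      then obtain k' where k': "k = Suc k'" "horiz i k' \<in> Q"
        using alone[OF k(2,3)] by blast
      then have "even (k' - run_start g f i)" "run_start g f i \<le> k'"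
        using less.IH[of k'] k horiz_in by auto
      then show ?thesis using k k' by (simp add: Suc_diff_le)
    qed simp
  qed
  have strip: "domino_strip g f"
    unfolding domino_strip_def
  proof (intro allI conjI)
    fix i
    show le_i: "run_start g f i \<le> run_end g f i"
      using le[of i] f_dec[of i] g_dec two by (cases i) (auto simp: run_start_def run_end_def)
    \<comment> \<open>The last box of a run is the right half of its domino, as no domino extends
      beyond the run; the parity of its left half makes the length even.\<close>
    show "even (run_end g f i - run_start g f i)"
    proof (cases "run_start g f i = run_end g f i")
      case False
      then obtain k where k: "run_end g f i = Suc k" "run_start g f i \<le> k"
        using le_i by (cases "run_end g f i") auto
      then obtain k' where k': "k = Suc k'" "horiz i k' \<in> Q"
        using alone[of i k] horiz_in[of i k] by auto
      then show ?thesis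
        using parity[OF k'(2)] horiz_in[OF k'(2)] k by (simp add: Suc_diff_le)
    qed simp
  qed
  have "Q \<subseteq> strip_dominoes g f"
  proof
    fix d assume d: "d \<in> Q"
    from dom[OF d] show "d \<in> strip_dominoes g f"
    proof (cases rule: domino_cases)
      case (1 i j)
      then show ?thesis
        using d parity[of i j] horiz_in[of i j] unfolding strip_dominoes_def by blast
    next
      case (2 i j)
      then show ?thesis
        using sub[OF d, of i j] sub[OF d, of "Suc i" j] unfolding strip_dominoes_def by blast
    qed
  qed
  moreover have "d \<in> Q" if d: "d \<in> strip_dominoes g f" for d
  proof -
    obtain i j where ij: "(i, j) \<in> d" using d unfolding strip_dominoes_def by auto
    have "(i, j) \<in> \<Union> (strip_dominoes g f)" using d ij by blast
    then have "(i, j) \<in> boxes f - boxes g"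
      using strip_tiling_strip_dominoes[OF strip] partition_onD1 unfolding strip_tiling_def by metis
    then obtain d' where d': "d' \<in> Q" "(i, j) \<in> d'" unfolding U[symmetric] by blast
    then have "d' = d"
      using \<open>Q \<subseteq> strip_dominoes g f\<close> strip_dominoes_column[OF strip _ d _ ij] by blast
    then show ?thesis using d' by simp
  qed
  ultimately show ?thesis using strip by blast
qed

lemma strip_tiling_size:
  assumes Q: "strip_tiling g f Q"
  shows "ysize f = ysize g + 2 * card Q"
proof -
  have P: "partition_on (boxes f - boxes g) Q" and dom: "\<And>d. d \<in> Q \<Longrightarrow> domino d"
    using Q by (auto simp: strip_tiling_def)
  have card2: "card d = 2 \<and> finite d" if "d \<in> Q" for d
    using dom[OF that] by (cases rule: domino_cases) auto
  have "boxes g \<subseteq> boxes f"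
    using less_le_trans[OF _ le] by (simp add: boxes_def) blast
  then have "ysize f - ysize g = card (boxes f - boxes g)"
    using card_boxes[OF f] card_boxes[OF g] by (simp add: card_Diff_subset)
  also have "\<dots> = card (\<Union> Q)"
    using partition_onD1[OF P] by simp
  also have "\<dots> = (\<Sum>d\<in>Q. card d)"
    using partition_onD2[OF P] card2
    by (intro card_Union_disjoint) (auto simp: disjoint_def pairwise_def disjnt_def)
  also have "\<dots> = 2 * card Q"
    using card2 by simp
  finally show ?thesis
    using ysize_mono[OF f le] by simp
qed

end

section \<open>Domino tableaux\<close>

definition domino_tableaux_of ::
    "nat \<Rightarrow> (nat \<Rightarrow> nat) \<Rightarrow> (nat \<Rightarrow> nat) \<Rightarrow> ((nat \<times> nat) set set \<times> ((nat \<times> nat) set \<Rightarrow> nat)) set" where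
  "domino_tableaux_of l m f = {(P, F). m 0 \<le> f 0 \<and> partition_on (boxes f - {0} \<times> {..<m 0}) P \<and>
     (\<forall>d\<in>P. domino d) \<and> F \<in> P \<rightarrow>\<^sub>E {1..l} \<and> (\<forall>i\<in>{1..l}. card {d \<in> P. F d = i} = m i) \<and>
     (\<forall>d\<in>P. \<forall>d'\<in>P. \<forall>i j j'. (i, j) \<in> d \<longrightarrow> (i, j') \<in> d' \<longrightarrow> j < j' \<longrightarrow> F d \<le> F d') \<and>
     (\<forall>d\<in>P. \<forall>d'\<in>P. \<forall>i i' j.
        d \<noteq> d' \<longrightarrow> (i, j) \<in> d \<longrightarrow> (i', j) \<in> d' \<longrightarrow> i < i' \<longrightarrow> F d < F d')}"

lemma domino_tableaux_part: "domino_tableaux l m \<mu> = domino_tableaux_of l m (part \<mu>)"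
  by (simp add: domino_tableaux_def domino_tableaux_of_def diagram_boxes)

lemma domino_tableaux_ofD:
  assumes "(P, F) \<in> domino_tableaux_of l m f"
  shows "m 0 \<le> f 0" "\<Union> P = boxes f - {0} \<times> {..<m 0}" "disjoint P" "{} \<notin> P"
    "\<And>d. d \<in> P \<Longrightarrow> domino d" "F \<in> P \<rightarrow>\<^sub>E {1..l}"
    "\<And>i. i \<in> {1..l} \<Longrightarrow> card {d \<in> P. F d = i} = m i"
    "\<And>d d' i j j'. d \<in> P \<Longrightarrow> d' \<in> P \<Longrightarrow> (i, j) \<in> d \<Longrightarrow> (i, j') \<in> d' \<Longrightarrow> j < j' \<Longrightarrow> F d \<le> F d'"
    "\<And>d d' i i' j. d \<in> P \<Longrightarrow> d' \<in> P \<Longrightarrow> d \<noteq> d' \<Longrightarrow> (i, j) \<in> d \<Longrightarrow> (i', j) \<in> d' \<Longrightarrow> i < i' \<Longrightarrow>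
       F d < F d'"
proof -
  note 1 = assms[unfolded domino_tableaux_of_def mem_Collect_eq prod.case]
  note 2 = conjunct2[OF 1]
  note 3 = conjunct2[OF 2]
  note 4 = conjunct2[OF 3]
  note 5 = conjunct2[OF 4]
  note 6 = conjunct2[OF 5]
  note P = conjunct1[OF 2]
  show "\<Union> P = boxes f - {0} \<times> {..<m 0}" using partition_onD1[OF P] by simp
  show "disjoint P" "{} \<notin> P" using partition_onD2[OF P] partition_onD3[OF P] by auto
  show "m 0 \<le> f 0" by (rule conjunct1[OF 1])
  show "F \<in> P \<rightarrow>\<^sub>E {1..l}" by (rule conjunct1[OF 4])
  show "domino d" if "d \<in> P" for d
    using conjunct1[OF 3] that by blast
  show "card {d \<in> P. F d = i} = m i" if "i \<in> {1..l}" for i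
    using conjunct1[OF 5] that by blast
  show "F d \<le> F d'" if "d \<in> P" "d' \<in> P" "(i, j) \<in> d" "(i, j') \<in> d'" "j < j'" for d d' i j j'
    using conjunct1[OF 6] that by blast
  show "F d < F d'" if "d \<in> P" "d' \<in> P" "d \<noteq> d'" "(i, j) \<in> d" "(i', j) \<in> d'" "i < i'" for d d' i i' j
    using conjunct2[OF 6] that by blast
qed

section \<open>Removal of the dominoes with the largest label\<close>

lemma finite_domino_tableaux_of:
  assumes "young f"
  shows "finite (domino_tableaux_of l m f)"
proof (rule finite_subset)
  let ?S = "SIGMA P:Pow (Pow (boxes f)). P \<rightarrow>\<^sub>E {1..l}"
  show "domino_tableaux_of l m f \<subseteq> ?S"
  proof
    fix x assume "x \<in> domino_tableaux_of l m f"
    moreover obtain P F where "x = (P, F)" by (cases x)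
    ultimately have x: "x = (P, F)" "(P, F) \<in> domino_tableaux_of l m f" by auto
    have "P \<subseteq> Pow (boxes f)" using domino_tableaux_ofD(2)[OF x(2)] by blast
    then show "x \<in> ?S" using domino_tableaux_ofD(6)[OF x(2)] x(1) by simp
  qed
  have fin: "finite (Pow (boxes f))" using card_boxes(1)[OF assms] by simp
  then show "finite ?S"
    by (intro finite_SigmaI finite_PiE) (auto intro: finite_subset[OF _ fin])
qed

text \<open>Monotonicity of the labels makes the zeros and the dominoes labelled at most
  \<open>l\<close> a down-closed set of boxes. Distinct dominoes with the same label never meet a
  common column, since labels increase strictly there, so those labelled \<open>Suc l\<close> form a
  strip tiling of the rest.\<close>

lemma domino_tableaux_of_peel:
  assumes f: "young f" and PF: "(P, F) \<in> domino_tableaux_of (Suc l) m f"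
  defines "P' \<equiv> {d \<in> P. F d \<le> l}" and "Q \<equiv> {d \<in> P. F d = Suc l}"
  shows "\<exists>g. young g \<and> boxes g = {0} \<times> {..<m 0} \<union> \<Union> P' \<and> (\<forall>i. g i \<le> f i) \<and>
    strip_tiling g f Q \<and> (P', restrict F P') \<in> domino_tableaux_of l m g"
proof -
  note D = domino_tableaux_ofD[OF PF]
  let ?Z = "{0} \<times> {..<m 0}"
  let ?S = "?Z \<union> \<Union> P'"
  have F_range: "1 \<le> F d \<and> F d \<le> Suc l" if "d \<in> P" for d
    using PiE_mem[OF D(6) that] by simp
  have P_eq: "P = P' \<union> Q" using F_range by (auto simp: P'_def Q_def le_Suc_eq)
  have Z: "?Z \<subseteq> boxes f" using D(1) by (auto simp: boxes_def)
  have S_f: "?S \<subseteq> boxes f" using Z D(2) unfolding P'_def by blast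
  have disj: "d = d'" if "d \<in> P" "d' \<in> P" "b \<in> d" "b \<in> d'" for d d' b
    using D(3) that unfolding disjoint_def by blast
  have row: "(i, j') \<in> ?S" if S: "(i, j) \<in> ?S" "j' \<le> j" for i j j'
  proof (cases "(i, j') \<in> ?Z \<or> j = j'")
    case False
    have "(i, j) \<notin> ?Z" using False that(2) by auto
    then obtain d where d: "d \<in> P'" "(i, j) \<in> d" using S(1) by blast
    have "(i, j) \<in> boxes f" using S_f that(1) by blast
    then have "(i, j') \<in> \<Union> P" using False that(2) unfolding D(2) by auto
    then obtain d' where d': "d' \<in> P" "(i, j') \<in> d'" by blast
    have "F d' \<le> F d"
      using D(8)[OF d'(1) _ d'(2) d(2)] d(1) that(2) False by (auto simp: P'_def)
    then show ?thesis using d d' unfolding P'_def by auto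
  qed (use that in auto)
  have col: "(i', j) \<in> ?S" if S: "(i, j) \<in> ?S" "i' \<le> i" for i i' j
  proof (cases "(i', j) \<in> ?Z \<or> i = i'")
    case False
    have "(i, j) \<notin> ?Z" using False that(2) by auto
    then obtain d where d: "d \<in> P'" "(i, j) \<in> d" using S(1) by blast
    have "(i, j) \<in> boxes f" using S_f that(1) by blast
    then have "(i', j) \<in> boxes f" using youngD[OF f that(2)] by (auto intro: less_le_trans)
    then have "(i', j) \<in> \<Union> P" using False unfolding D(2) by blast
    then obtain d' where d': "d' \<in> P" "(i', j) \<in> d'" by blast
    \<comment> \<open>Both boxes can lie in one vertical domino; the strict inequality is available
      only for distinct ones.\<close>
    have "F d' \<le> F d"
    proof (cases "d = d'")
      case False
      have "d \<in> P" using d(1) by (simp add: P'_def)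
      then have "F d' < F d"
        using D(9)[OF d'(1) _ _ d'(2) d(2)] that(2) False \<open>\<not> ((i', j) \<in> ?Z \<or> i = i')\<close> by auto
      then show ?thesis by simp
    qed simp
    then show ?thesis using d d' unfolding P'_def by auto
  qed (use that in auto)
  obtain g where g: "young g" "boxes g = ?S"
    using young_of_boxes[of ?S] finite_subset[OF S_f card_boxes(1)[OF f]] row col by metis
  have le: "g i \<le> f i" for i
  proof (rule ccontr)
    assume "\<not> ?thesis"
    then have "(i, f i) \<in> boxes g" by simp
    then have "(i, f i) \<in> boxes f" using S_f unfolding g(2) by blast
    then show False by simp
  qed
  have Q: "\<Union> Q = boxes f - boxes g"
  proof -
    have "b \<notin> ?Z" if "d \<in> P" "b \<in> d" for b d using D(2) that by blast
    then have "\<Union> Q \<inter> ?S = {}"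
      using disj unfolding Q_def P'_def by fastforce
    moreover have "\<Union> P' \<union> \<Union> Q = boxes f - ?Z"
      using D(2) P_eq by auto
    ultimately show ?thesis using Z unfolding g(2) by blast
  qed
  have tiling: "strip_tiling g f Q"
    unfolding strip_tiling_def
  proof (intro conjI ballI allI impI)
    show "partition_on (boxes f - boxes g) Q"
      using Q D(3,4) by (intro partition_onI) (auto simp: Q_def disjoint_def disjnt_def)
    show "domino d" if "d \<in> Q" for d using that D(5) by (simp add: Q_def)
    fix d d' i i' j assume d: "d \<in> Q" "d' \<in> Q" "(i, j) \<in> d" "(i', j) \<in> d'"
    then have P: "d \<in> P" "d' \<in> P" "F d = F d'" by (auto simp: Q_def)
    show "d = d'"
    proof (cases i i' rule: linorder_cases)
      case equal
      then show ?thesis using disj P d by blast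
    next
      case less
      then show ?thesis using D(9)[OF P(1,2) _ d(3,4)] P(3) by auto
    next
      case greater
      then show ?thesis using D(9)[OF P(2,1) _ d(4,3)] P(3) by auto
    qed
  qed
  have "(P', restrict F P') \<in> domino_tableaux_of l m g"
  proof -
    have "(0, j) \<in> boxes g" if "j < m 0" for j using that unfolding g(2) by simp
    then have "m 0 \<le> g 0" by (meson mem_boxes less_irrefl not_le)
    moreover have "partition_on (boxes g - ?Z) P'"
    proof (rule partition_onI)
      have "b \<notin> ?Z" if "d \<in> P'" "b \<in> d" for b d using D(2) that unfolding P'_def by blast
      then show "\<Union> P' = boxes g - ?Z" unfolding g(2) by blast
    qed (use D(3,4) in \<open>auto simp: P'_def disjoint_def disjnt_def\<close>)
    moreover have "restrict F P' \<in> P' \<rightarrow>\<^sub>E {1..l}"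
      using F_range by (auto simp: P'_def)
    moreover have "card {d \<in> P'. restrict F P' d = i} = m i" if "i \<in> {1..l}" for i
    proof -
      have "{d \<in> P'. restrict F P' d = i} = {d \<in> P. F d = i}"
        using that by (auto simp: P'_def)
      then show ?thesis using D(7)[of i] that by simp
    qed
    ultimately show ?thesis
      unfolding domino_tableaux_of_def using D(5,8,9) by (auto simp: P'_def)
  qed
  then show ?thesis using g le tiling by blast
qed

text \<open>The new label exceeds all old ones, and a box outside \<open>g\<close> never lies to the
  left of or above a box of \<open>g\<close>, so old and new dominoes are in the right order. Two
  new ones share no column and have equal labels, which rows permit.\<close>

lemma domino_tableaux_of_extend:
  assumes f: "young f" and g: "young g" and le: "\<And>i. g i \<le> f i"
    and Q: "strip_tiling g f Q" "card Q = m (Suc l)" and PF: "(P, F) \<in> domino_tableaux_of l m g"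
  defines "F' \<equiv> \<lambda>d\<in>P \<union> Q. if d \<in> P then F d else Suc l"
  shows "(P \<union> Q, F') \<in> domino_tableaux_of (Suc l) m f" and "P \<inter> Q = {}"
    and "\<And>d. d \<in> P \<Longrightarrow> F d \<le> l"
proof -
  note D = domino_tableaux_ofD[OF PF]
  let ?Z = "{0} \<times> {..<m 0}"
  have Qp: "partition_on (boxes f - boxes g) Q" using Q(1) by (simp add: strip_tiling_def)
  have QU: "\<Union> Q = boxes f - boxes g" using partition_onD1[OF Qp] by simp
  have Qcol: "d = d'" if "d \<in> Q" "d' \<in> Q" "(i, j) \<in> d" "(i', j) \<in> d'" for d d' i i' j
    using Q(1) that unfolding strip_tiling_def by blast
  have Qdom: "domino d" if "d \<in> Q" for d
    using Q(1) that unfolding strip_tiling_def by blast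
  have inP: "j < g i" if "d \<in> P" "(i, j) \<in> d" for d i j
  proof -
    have "(i, j) \<in> boxes g" using D(2) that by blast
    then show ?thesis by simp
  qed
  have inQ: "g i \<le> j \<and> j < f i" if "d \<in> Q" "(i, j) \<in> d" for d i j
  proof -
    have "(i, j) \<in> boxes f - boxes g" using QU that by blast
    then show ?thesis by simp
  qed
  have F_range: "F d \<in> {1..l}" if "d \<in> P" for d
    using PiE_mem[OF D(6) that] .
  then show "F d \<le> l" if "d \<in> P" for d using that by simp
  have sub: "boxes g \<subseteq> boxes f"
    using less_le_trans[OF _ le] by (simp add: boxes_def) blast
  show PQ: "P \<inter> Q = {}"
  proof -
    have False if "d \<in> P" "d \<in> Q" for d
    proof -
      obtain i j where "(i, j) \<in> d" using D(4) \<open>d \<in> P\<close> by (metis all_not_in_conv surj_pair)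
      then show False using inP inQ that by fastforce
    qed
    then show ?thesis by blast
  qed
  have F'_P: "F' d = F d" if "d \<in> P" for d using that by (simp add: F'_def)
  have F'_Q: "F' d = Suc l" if "d \<in> Q" for d using that PQ by (auto simp: F'_def)
  have c1: "m 0 \<le> f 0" using D(1) le[of 0] by simp
  have c2: "partition_on (boxes f - ?Z) (P \<union> Q)"
  proof (rule partition_onI)
    have "?Z \<subseteq> boxes g" using D(1) by (auto simp: boxes_def)
    then show "\<Union> (P \<union> Q) = boxes f - ?Z" using D(2) QU sub by blast
    show "{} \<notin> P \<union> Q" using D(4) partition_onD3[OF Qp] by simp
    show "disjnt d d'" if d: "d \<in> P \<union> Q" "d' \<in> P \<union> Q" "d \<noteq> d'" for d d'
    proof -
      have "disjnt d d'" if "d \<in> P" "d' \<in> Q" for d d'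
        using D(2) QU that unfolding disjnt_def by blast
      moreover have "disjnt d d'" if "d \<in> P" "d' \<in> P" "d \<noteq> d'" for d d'
        using D(3) that by (simp add: disjoint_def disjnt_def)
      moreover have "disjnt d d'" if "d \<in> Q" "d' \<in> Q" "d \<noteq> d'" for d d'
        using partition_onD2[OF Qp] that by (simp add: disjoint_def disjnt_def)
      ultimately show ?thesis using d disjnt_sym by blast
    qed
  qed
  have "F d \<in> {1..Suc l}" if "d \<in> P" for d
    using F_range[OF that] by simp
  then have c4: "F' \<in> P \<union> Q \<rightarrow>\<^sub>E {1..Suc l}"
    by (auto simp: F'_def)
  have c5: "card {d \<in> P \<union> Q. F' d = i} = m i" if "i \<in> {1..Suc l}" for i
  proof (cases "i = Suc l")
    case True
    then have "{d \<in> P \<union> Q. F' d = i} = Q"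
      using F_range F'_P F'_Q by fastforce
    then show ?thesis using Q(2) True by simp
  next
    case False
    then have "{d \<in> P \<union> Q. F' d = i} = {d \<in> P. F d = i}"
      using that F'_P F'_Q by auto
    then show ?thesis using D(7)[of i] that False by simp
  qed
  have c6: "F' d \<le> F' d'"
    if d: "d \<in> P \<union> Q" "d' \<in> P \<union> Q" "(i, j) \<in> d" "(i, j') \<in> d'" "j < j'" for d d' i j j'
  proof (cases "d' \<in> P")
    case True
    moreover have "d \<notin> Q" using inP[OF True d(4)] inQ[of d i j] d(3,5) by auto
    ultimately show ?thesis using D(8)[of d d' i j j'] d F'_P by auto
  next
    case False
    then have "F' d' = Suc l" using d F'_Q by blast
    then show ?thesis using d(1) F'_P F'_Q F_range by fastforce
  qed
  have c7: "F' d < F' d'"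
    if d: "d \<in> P \<union> Q" "d' \<in> P \<union> Q" "d \<noteq> d'" "(i, j) \<in> d" "(i', j) \<in> d'" "i < i'" for d d' i i' j
  proof (cases "d' \<in> P")
    case True
    have "d \<notin> Q"
      using inP[OF True d(5)] inQ[of d i j] d(4) youngD[OF g, of i i'] d(6) by auto
    then show ?thesis using D(9)[of d d' i j i'] d True F'_P by auto
  next
    case False
    then have d': "d' \<in> Q" using d by blast
    then have "d \<in> P" using Qcol[of d d'] d by blast
    then show ?thesis using d' F'_P F'_Q F_range by fastforce
  qed
  have c3: "domino d" if "d \<in> P \<union> Q" for d using that D(5) Qdom by blast
  show "(P \<union> Q, F') \<in> domino_tableaux_of (Suc l) m f"
    unfolding domino_tableaux_of_def mem_Collect_eq prod.case
    by (intro conjI ballI allI impI, rule c1, rule c2, erule c3, rule c4, erule c5,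
        (rule c6; assumption), (rule c7; assumption))
qed

text \<open>Since \<open>f / g\<close> has exactly one strip tiling if
  \<open>domino_strip g f\<close> and none otherwise, a tableau is determined by the part with
  labels up to \<open>l\<close>, and every shape \<open>g\<close> counts with multiplicity
  one.\<close>

lemma card_domino_tableaux_of_Suc:
  assumes f: "f \<in> youngs (n + 2 * m (Suc l))"
  shows "card (domino_tableaux_of (Suc l) m f) =
    (\<Sum>g | g \<in> youngs n \<and> domino_strip g f. card (domino_tableaux_of l m g))"
proof -
  have yf: "young f" "ysize f = n + 2 * m (Suc l)" using f by (auto simp: youngs_def)
  let ?G = "{g. g \<in> youngs n \<and> domino_strip g f}"
  let ?low = "\<lambda>P F. {d \<in> P. F d \<le> l}"
  let ?S = "\<lambda>P F. {0} \<times> {..<m 0} \<union> \<Union> (?low P F)"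
  define Y where "Y g = {(P, F) \<in> domino_tableaux_of (Suc l) m f. ?S P F = boxes g}" for g
  have Y: "(P, F) \<in> Y g \<longleftrightarrow> (P, F) \<in> domino_tableaux_of (Suc l) m f \<and> ?S P F = boxes g" for P F g
    unfolding Y_def by blast
  have peel: "\<exists>g\<in>?G. boxes g = ?S P F \<and> strip_tiling g f {d \<in> P. F d = Suc l} \<and>
      (?low P F, restrict F (?low P F)) \<in> domino_tableaux_of l m g"
    if PF: "(P, F) \<in> domino_tableaux_of (Suc l) m f" for P F
  proof -
    obtain g where g: "young g" "boxes g = ?S P F" "\<And>i. g i \<le> f i"
        "strip_tiling g f {d \<in> P. F d = Suc l}" "(?low P F, restrict F (?low P F)) \<in> domino_tableaux_of l m g"
      using domino_tableaux_of_peel[OF yf(1) PF] by blast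
    have "domino_strip g f"
      using strip_tiling_unique[OF g(1) yf(1) g(3,4)] by simp
    moreover have "ysize g = n"
      using strip_tiling_size[OF g(1) yf(1) g(3,4)] domino_tableaux_ofD(7)[OF PF, of "Suc l"] yf(2) by simp
    ultimately show ?thesis using g by (auto simp: youngs_def)
  qed
  have "domino_tableaux_of (Suc l) m f = (\<Union>g\<in>?G. Y g)"
  proof (intro set_eqI iffI)
    fix x assume x: "x \<in> domino_tableaux_of (Suc l) m f"
    obtain P F where PF: "x = (P, F)" by (cases x)
    from peel[of P F] x obtain g where "g \<in> ?G" "boxes g = ?S P F" unfolding PF by blast
    then have "g \<in> ?G" "x \<in> Y g" using x unfolding PF Y by simp_all
    then show "x \<in> (\<Union>g\<in>?G. Y g)" by blast
  next
    fix x assume "x \<in> (\<Union>g\<in>?G. Y g)"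
    then obtain g where "x \<in> Y g" by blast
    then show "x \<in> domino_tableaux_of (Suc l) m f" by (cases x) (simp only: Y)
  qed
  moreover have "finite (Y g)" for g
    using finite_domino_tableaux_of[OF yf(1)]
  proof (rule finite_subset[rotated])
    show "Y g \<subseteq> domino_tableaux_of (Suc l) m f" using Y by auto
  qed
  moreover have "Y g \<inter> Y h = {}" if "g \<noteq> h" for g h
  proof (rule equals0I)
    fix x assume x: "x \<in> Y g \<inter> Y h"
    obtain P F where PF: "x = (P, F)" by (cases x)
    from x have "boxes g = boxes h" unfolding PF Int_iff Y by metis
    then show False using boxes_inject that by blast
  qed
  moreover have "finite ?G" using finite_youngs[of n] by simp
  ultimately have "card (domino_tableaux_of (Suc l) m f) = (\<Sum>g\<in>?G. card (Y g))"
    by (simp add: card_UN_disjoint)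
  also have "\<dots> = (\<Sum>g\<in>?G. card (domino_tableaux_of l m g))"
  proof (rule sum.cong[OF refl])
    fix g assume "g \<in> ?G"
    then have g: "young g" "ysize g = n" "domino_strip g f" by (auto simp: youngs_def)
    have le: "g i \<le> f i" for i using domino_strip_le(1)[OF g(3)] .
    let ?Q = "strip_dominoes g f"
    have Q: "strip_tiling g f ?Q"
      by (rule strip_tiling_strip_dominoes[OF g(1) yf(1) le g(3)])
    have cQ: "card ?Q = m (Suc l)"
      using strip_tiling_size[OF g(1) yf(1) le Q] g(2) yf(2) by simp
    let ?r = "\<lambda>(P, F). (?low P F, restrict F (?low P F))"
    let ?F = "\<lambda>P F. \<lambda>d\<in>P \<union> ?Q. if d \<in> P then F d else Suc l"
    let ?e = "\<lambda>(P, F). (P \<union> ?Q, ?F P F)"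
    note ext = domino_tableaux_of_extend[where f = f and g = g and Q = ?Q and m = m and l = l, OF yf(1) g(1) le Q cQ]
    have low: "?low (P \<union> ?Q) (?F P F) = P" if "(P, F) \<in> domino_tableaux_of l m g" for P F
      using ext(2,3)[OF that] by auto
    have "bij_betw ?r (Y g) (domino_tableaux_of l m g)"
    proof (rule bij_betw_byWitness[of _ ?e])
      show "\<forall>x\<in>Y g. ?e (?r x) = x"
      proof
        fix x assume x: "x \<in> Y g"
        obtain P F where PF: "x = (P, F)" by (cases x)
        then have 1: "(P, F) \<in> domino_tableaux_of (Suc l) m f" "?S P F = boxes g"
          using x Y by simp_all
        obtain g' where "boxes g' = ?S P F" "strip_tiling g' f {d \<in> P. F d = Suc l}"
          using peel[OF 1(1)] by blast
        then have "strip_tiling g f {d \<in> P. F d = Suc l}"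
          using 1(2) boxes_inject by metis
        \<comment> \<open>By uniqueness the removed dominoes are the canonical ones, so adding
          \<open>?Q\<close> restores the original tiling.\<close>
        then have Q_eq: "?Q = {d \<in> P. F d = Suc l}"
          using strip_tiling_unique[OF g(1) yf(1) le] by blast
        have F_range: "F d \<le> Suc l" if "d \<in> P" for d
          using PiE_mem[OF domino_tableaux_ofD(6)[OF 1(1)] that] by simp
        have P_eq: "?low P F \<union> ?Q = P"
          unfolding Q_eq using F_range by (auto simp: le_Suc_eq)
        have "?F (?low P F) (restrict F (?low P F)) d = F d" for d
          using PiE_arb[OF domino_tableaux_ofD(6)[OF 1(1)], of d] F_range[of d] unfolding P_eq
          by (cases "d \<in> P") auto
        then show "?e (?r x) = x"
          unfolding PF prod.case P_eq by (auto simp: P_eq)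
      qed
      have re: "?r (?e (P, F)) = (P, F)" if "(P, F) \<in> domino_tableaux_of l m g" for P F
      proof -
        have "restrict (?F P F) P d = F d" for d
          using PiE_arb[OF domino_tableaux_ofD(6)[OF that], of d] by (cases "d \<in> P") auto
        then show ?thesis unfolding prod.case low[OF that] by blast
      qed
      show "\<forall>x\<in>domino_tableaux_of l m g. ?r (?e x) = x"
      proof
        fix x assume "x \<in> domino_tableaux_of l m g"
        then show "?r (?e x) = x" by (cases x) (simp only: re)
      qed
      show "?r ` Y g \<subseteq> domino_tableaux_of l m g"
      proof (rule image_subsetI)
        fix x assume x: "x \<in> Y g"
        obtain P F where PF: "x = (P, F)" by (cases x)
        then have 1: "(P, F) \<in> domino_tableaux_of (Suc l) m f" "?S P F = boxes g"
          using x Y by simp_all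
        obtain g' where g': "boxes g' = ?S P F"
          "(?low P F, restrict F (?low P F)) \<in> domino_tableaux_of l m g'"
          using peel[OF 1(1)] by blast
        have "boxes g' = boxes g" using g'(1) 1(2) by (rule trans)
        then have "g' = g" by (simp only: boxes_inject)
        show "?r x \<in> domino_tableaux_of l m g"
          using g'(2) unfolding PF prod.case \<open>g' = g\<close> .
      qed
      show "?e ` domino_tableaux_of l m g \<subseteq> Y g"
      proof (rule image_subsetI)
        fix x assume x: "x \<in> domino_tableaux_of l m g"
        obtain P F where PF: "x = (P, F)" by (cases x)
        then have 1: "(P, F) \<in> domino_tableaux_of l m g" using x by simp
        have "{0} \<times> {..<m 0} \<subseteq> boxes g"
          using domino_tableaux_ofD(1)[OF 1] by (auto simp: boxes_def)
        then have "{0} \<times> {..<m 0} \<union> \<Union> P = boxes g"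
          using domino_tableaux_ofD(2)[OF 1] by blast
        then show "?e x \<in> Y g"
          unfolding PF prod.case Y low[OF 1] using ext(1)[OF 1] by blast
      qed
    qed
    then show "card (Y g) = card (domino_tableaux_of l m g)" by (rule bij_betw_same_card)
  qed
  finally show ?thesis .
qed

lemma domino_tableaux_of_0:
  assumes "f \<in> youngs (m 0)"
  shows "card (domino_tableaux_of 0 m f) = (if f = row_shape (m 0) then 1 else 0)"
proof -
  have f: "young f" "ysize f = m 0" using assms by (auto simp: youngs_def)
  have iff: "m 0 \<le> f 0 \<and> boxes f - {0} \<times> {..<m 0} = {} \<longleftrightarrow> f = row_shape (m 0)"
  proof
    assume *: "m 0 \<le> f 0 \<and> boxes f - {0} \<times> {..<m 0} = {}"
    have "f i = row_shape (m 0) i" for i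
    proof (cases i)
      case 0
      then show ?thesis using * young_le_ysize[OF f(1), of 0] f(2) by (simp add: row_shape_def)
    next
      case (Suc k)
      have "(i, 0) \<notin> {0} \<times> {..<m 0}" using Suc by simp
      then have "(i, 0) \<notin> boxes f" using * by blast
      then show ?thesis using Suc by (simp add: row_shape_def)
    qed
    then show "f = row_shape (m 0)" by blast
  qed (auto simp: row_shape_def boxes_def split: if_splits)
  have "domino_tableaux_of 0 m f = {(P, F). (m 0 \<le> f 0 \<and> boxes f - {0} \<times> {..<m 0} = {}) \<and> P = {} \<and> F = (\<lambda>_. undefined)}"
  proof (rule set_eqI, clarify)
    fix P and F :: "(nat \<times> nat) set \<Rightarrow> nat"
    show "(P, F) \<in> domino_tableaux_of 0 m f \<longleftrightarrow> (P, F) \<in>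
        {(P, F). (m 0 \<le> f 0 \<and> boxes f - {0} \<times> {..<m 0} = {}) \<and> P = {} \<and> F = (\<lambda>_. undefined)}"
    proof (cases "P = {}")
      case True
      then show ?thesis by (auto simp: domino_tableaux_of_def partition_on_def)
    next
      case False
      then have "P \<rightarrow>\<^sub>E {1..0 :: nat} = {}" by (auto simp: PiE_eq_empty_iff)
      then have "(P, F) \<notin> domino_tableaux_of 0 m f" using domino_tableaux_ofD(6)[of P F 0 m f] by blast
      then show ?thesis using False by simp
    qed
  qed
  also have "\<dots> = (if f = row_shape (m 0) then {({}, \<lambda>_. undefined)} else {})"
    unfolding iff by auto
  finally show ?thesis by simp
qed

text \<open>The step from \<open>g\<close> to \<open>f\<close> has the sign (-1)^(n(f) + n(g)); the
  coefficient of \<open>g\<close> already carries (-1)^(n(g)), so (-1)^(n(f)) is left.\<close>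

lemma domino_identity:
  "schurf (row_shape (m 0)) *
     (\<Prod>r=1..l. \<Sum>i=0..2 * m r. (-1) ^ i * schurf (row_shape i) * schurf (row_shape (2 * m r - i))) =
    (\<Sum>f\<in>youngs (m 0 + (\<Sum>r=1..l. 2 * m r)).
      ((-1) ^ nstat f * of_nat (card (domino_tableaux_of l m f))) * schurf f)"
proof (induction l)
  case 0
  have "nstat (row_shape (m 0)) = 0"
    by (simp add: nstat_def row_shape_def)
  then have "(\<Sum>f\<in>youngs (m 0). ((-1) ^ nstat f * of_nat (card (domino_tableaux_of 0 m f))) * schurf f) =
      (\<Sum>f\<in>youngs (m 0). if f = row_shape (m 0) then schurf f else 0)"
    by (intro sum.cong) (auto simp: domino_tableaux_of_0)
  also have "\<dots> = schurf (row_shape (m 0))"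
    by (simp add: finite_youngs) (simp add: youngs_def young_row_shape)
  finally show ?case by simp
next
  case (Suc l)
  let ?n = "m 0 + (\<Sum>r=1..l. 2 * m r)"
  let ?c = "\<lambda>l f. (-1) ^ nstat f * of_nat (card (domino_tableaux_of l m f)) :: mfps"
  have "schurf (row_shape (m 0)) *
     (\<Prod>r=1..Suc l. \<Sum>i=0..2 * m r. (-1) ^ i * schurf (row_shape i) * schurf (row_shape (2 * m r - i))) =
      (\<Sum>f\<in>youngs ?n. ?c l f * schurf f) *
      (\<Sum>i=0..2 * m (Suc l). (-1) ^ i * schurf (row_shape i) * schurf (row_shape (2 * m (Suc l) - i)))"
    unfolding Suc.IH[symmetric] by (simp add: mult.assoc)
  also have "\<dots> = (\<Sum>f\<in>youngs (?n + 2 * m (Suc l)). ?c (Suc l) f * schurf f)"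
    unfolding two_rows_times_schurf_sum
  proof (rule sum.cong[OF refl])
    fix f assume f: "f \<in> youngs (?n + 2 * m (Suc l))"
    then have yf: "young f" by (simp add: youngs_def)
    have "(\<Sum>g\<in>youngs ?n. two_strip_sum (-1) g f * ?c l g) =
        (\<Sum>g\<in>youngs ?n. if domino_strip g f then (-1) ^ nstat f * of_nat (card (domino_tableaux_of l m g)) else 0)"
    proof (rule sum.cong[OF refl])
      fix g assume "g \<in> youngs ?n"
      then have "young g" by (simp add: youngs_def)
      then show "two_strip_sum (-1) g f * ?c l g =
          (if domino_strip g f then (-1) ^ nstat f * of_nat (card (domino_tableaux_of l m g)) else 0)"
        by (simp add: two_strip_sum_minus_one[OF yf] minus_one_power_iff)
    qed
    also have "\<dots> = (\<Sum>g\<in>youngs ?n \<inter> {g. domino_strip g f}. (-1) ^ nstat f * of_nat (card (domino_tableaux_of l m g)))"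
      by (simp add: sum.inter_restrict finite_youngs)
    also have "\<dots> = ?c (Suc l) f"
      by (simp add: card_domino_tableaux_of_Suc[where m = m and l = l, OF f] sum_distrib_left Int_def)
    finally show "(\<Sum>g\<in>youngs ?n. two_strip_sum (-1) g f * ?c l g) * schurf f = ?c (Suc l) f * schurf f"
      by simp
  qed
  finally show ?case by (simp add: add.assoc)
qed

section \<open>Return from functions to lists of parts\<close>

lemma sum_partitions:
  fixes C :: "(nat \<Rightarrow> nat) \<Rightarrow> mfps"
  shows "(\<Sum>\<mu>\<in>partitions n. C (part \<mu>) * schur \<mu>) = (\<Sum>f\<in>youngs n. C f * schurf f)"
  using sum.reindex_bij_betw[OF young_parts, of "\<lambda>f. C f * schurf f" n]
  by (simp add: schur_schurf youngs_def)

theorem lemma4p2: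
  fixes l n :: nat and m :: "nat \<Rightarrow> nat"
  assumes "(\<Sum>r=0..l. m r) = n"
  shows "schur [m 0] * (\<Prod>r=1..l. \<Sum>i=0..m r. schur [i] * schur [m r - i])
           = (\<Sum>\<mu>\<in>partitions n. of_nat (card (symplectic_tableaux l m \<mu>)) * schur \<mu>) \<and>
         schur [m 0] * (\<Prod>r=1..l. \<Sum>i=0..2 * m r. (-1) ^ i * schur [i] * schur [2 * m r - i])
           = (\<Sum>\<mu>\<in>partitions (2 * n - m 0).
                (-1) ^ n_stat \<mu> * of_nat (card (domino_tableaux l m \<mu>)) * schur \<mu>)"
proof
  have young: "young (part \<mu>)" if "\<mu> \<in> partitions k" for \<mu> k
    using bij_betw_apply[OF young_parts that] by simp
  have "(\<Sum>\<mu>\<in>partitions n. of_nat (card (symplectic_tableaux l m \<mu>)) * schur \<mu>) =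
      (\<Sum>\<mu>\<in>partitions n. of_nat (symplectic_count l m (part \<mu>)) * schur \<mu>)"
    by (rule sum.cong) (simp_all add: card_symplectic_tableaux young)
  also have "\<dots> = (\<Sum>f\<in>youngs n. of_nat (symplectic_count l m f) * schurf f)"
    by (rule sum_partitions)
  finally show "schur [m 0] * (\<Prod>r=1..l. \<Sum>i=0..m r. schur [i] * schur [m r - i])
      = (\<Sum>\<mu>\<in>partitions n. of_nat (card (symplectic_tableaux l m \<mu>)) * schur \<mu>)"
    using symplectic_identity[of m l] assms by (simp add: schur_schurf part_singleton)
  \<comment> \<open>This shows \<open>m 0 \<le> n\<close>, so the subtraction in
    \<open>2 * n - m 0\<close> is not truncated.\<close>
  have "n = m 0 + (\<Sum>r=1..l. m r)"
    using assms by (simp add: sum.atLeast_Suc_atMost)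
  then have "2 * n - m 0 = m 0 + (\<Sum>r=1..l. 2 * m r)"
    by (simp flip: sum_distrib_left)
  then show "schur [m 0] * (\<Prod>r=1..l. \<Sum>i=0..2 * m r. (-1) ^ i * schur [i] * schur [2 * m r - i])
      = (\<Sum>\<mu>\<in>partitions (2 * n - m 0).
          (-1) ^ n_stat \<mu> * of_nat (card (domino_tableaux l m \<mu>)) * schur \<mu>)"
    using domino_identity[of m l]
      sum_partitions[of "\<lambda>f. (-1) ^ nstat f * of_nat (card (domino_tableaux_of l m f))" "2 * n - m 0"]
    by (simp add: schur_schurf part_singleton n_stat_nstat domino_tableaux_part)
qed

end
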